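(* Let $\alpha>0$ and $0<p\le\infty$. If $Z=\{z_n\}$ is a sequence of points in the complex plane $\mathbb{C}$ satisfying $$\inf_{n\neq m}|z_n-z_m|>\sqrt{\frac{2\pi}{\sqrt{3}\,\alpha}},$$ then $Z$ is an interpolating sequence for the Fock space $F^p_\alpha$.
   Context: Let $dA$ denote area measure on $\mathbb{C}$. For $0<p\le\infty$ and $\alpha>0$, the Fock space $F^p_\alpha$ is the space of all entire functions $f$ such that $f(z)e^{-\frac{\alpha}{2}|z|^2}\in L^p(\mathbb{C},dA)$. For $0<p<\infty$ its norm is $\|f\|_{p,\alpha}=\left[\frac{p\alpha}{2\pi}\int_{\mathbb{C}}\left|f(z)e^{-\frac{\alpha}{2}|z|^2}\right|^p\,dA(z)\right]^{1/p}$, and for $p=\infty$, $\|f\|_{\infty,\alpha}=\sup_{z\in\mathbb{C}}|f(z)|e^{-\frac{\alpha}{2}|z|^2}$. A sequence $Z=\{z_n\}$ of distinct points in $\mathbb{C}$ is called an interpolating sequence for $F^p_\alpha$ if for every sequence $\{v_n\}$ of complex numbers with $\{v_ne^{-\frac{\alpha}{2}|z_n|^2}\}\in l^p$ there exists $f\in F^p_\alpha$ with $f(z_n)=v_n$ for all $n$. *)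

theory Defs
  imports "HOL-Analysis.Analysis"
begin

definition fock_weight :: "real \<Rightarrow> (complex \<Rightarrow> complex) \<Rightarrow> complex \<Rightarrow> real" where
  "fock_weight \<alpha> f z = norm (f z) * exp (- (\<alpha> / 2) * (norm z)^2)"

definition in_fock :: "ennreal \<Rightarrow> real \<Rightarrow> (complex \<Rightarrow> complex) \<Rightarrow> bool" where
  "in_fock p \<alpha> f \<longleftrightarrow> f holomorphic_on UNIV \<and>
     (if p = \<infinity> then bounded (range (fock_weight \<alpha> f))
      else integrable lborel (\<lambda>z. (fock_weight \<alpha> f z) powr (enn2real p)))"

definition in_lp :: "ennreal \<Rightarrow> (nat \<Rightarrow> real) \<Rightarrow> bool" where
  "in_lp p w \<longleftrightarrow>
     (if p = \<infinity> then bounded (range w)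
      else summable (\<lambda>n. \<bar>w n\<bar> powr (enn2real p)))"

definition interpolating_fock :: "ennreal \<Rightarrow> real \<Rightarrow> (nat \<Rightarrow> complex) \<Rightarrow> bool" where
  "interpolating_fock p \<alpha> z \<longleftrightarrow> inj z \<and>
     (\<forall>v :: nat \<Rightarrow> complex.
        in_lp p (\<lambda>n. norm (v n) * exp (- (\<alpha> / 2) * (norm (z n))^2)) \<longrightarrow>
        (\<exists>f. in_fock p \<alpha> f \<and> (\<forall>n. f (z n) = v n)))"

end

theory Submission
  imports Defs "HOL-Complex_Analysis.Complex_Analysis" "HOL-Real_Asymp.Real_Asymp"
begin

text \<open>Groemer's form of Thue's theorem bounds the number of points of a \<open>\<delta>\<close>-separated set in a square of
  side \<open>L\<close> by \<open>2 / (sqrt 3 * \<delta>\<^sup>2) * L\<^sup>2 + O(L)\<close>, so under the hypothesis every square of a suitable grid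
  contains at most \<open>K - 3\<close> points, where \<open>pi * K / L\<^sup>2 < \<alpha>\<close>. Rescale to the unit grid and let \<open>\<sigma>\<close> be an
  entire function with \<open>norm (\<sigma> z) * exp (- pi / 2 * (norm z)\<^sup>2)\<close> doubly periodic that vanishes at the
  cell centres \<open>c\<close>. In \<open>\<sigma> ^ K\<close> replace, cell by cell, \<open>(z - c) ^ K\<close> by a monic polynomial of degree \<open>K\<close> that
  vanishes at the points of the cell; three spare coefficients make the quotient of the two
  \<open>1 + O(norm (z - c) powr (-3))\<close>, which is summable over the grid, so the growth of \<open>\<sigma> ^ K\<close> is kept, and
  make it equal to 1 at a prescribed point of the sequence. The Weyl translates of these functions are
  dual to the sequence and, as \<open>pi * K / L\<^sup>2 < \<alpha>\<close>, decay like Gaussians in the weighted norm; hence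
  \<open>\<Sum>n. v n * g n\<close> interpolates.\<close>

subsection \<open>Packing in a square\<close>

unbundle no fps_syntax

text \<open>The hypothesis says that the density \<open>2 / (sqrt 3 * \<delta>\<^sup>2)\<close> of
  the hexagonal packing is below \<open>\<alpha> / pi\<close>, the density of zeros that the weight
  supports. The gap is spent twice: on the border term of the packing bound and the three spare
  degrees, both negligible against \<open>K\<close> for large cells, and on the Gaussian decay of
  the dual functions. The obstacle is uniformity: an arbitrary separated set is no perturbation of a
  lattice, so constants may depend on \<delta> and \<open>K\<close> only, neither on the base point
  nor on the number of points. The exponent 3 comes from the plane: about r cells lie at distance r,
  so an error of order 1/r^2 would diverge logarithmically, while 1/r^3 is summable. Two
  coefficients buy this; the third makes each cell's factor exactly 1 at the base point, so the
  product needs no lower bound there. Uniform constants also let one treat finitely many points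
  first and pass to the limit by normal families. The grid is recentred at every point of the
  sequence: the base point is the origin, a corner of four cells, where the quasi-periodic function
  does not vanish.\<close>

lemma lborel_complex_eq_pair:
  "(lborel :: complex measure) = distr (lborel \<Otimes>\<^sub>M lborel) borel (\<lambda>(x, y). Complex x y)"
proof (rule lborel_eqI)
  have m: "(\<lambda>(x, y). Complex x y) \<in> borel_measurable (lborel \<Otimes>\<^sub>M lborel)"
    unfolding lborel_prod by (simp add: Complex_eq split_beta borel_measurable_continuous_onI continuous_intros)
  fix l u :: complex
  assume le: "\<And>b. b \<in> Basis \<Longrightarrow> l \<bullet> b \<le> u \<bullet> b"
  have "Re l \<le> Re u" "Im l \<le> Im u"
    using le[of 1] le[of \<i>] by (simp_all add: Basis_complex_def)
  have "(\<lambda>(x, y). Complex x y) -` box l u = {Re l<..<Re u} \<times> {Im l<..<Im u}"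
    by (auto simp: in_box_complex_iff)
  then have "emeasure (distr (lborel \<Otimes>\<^sub>M lborel) borel (\<lambda>(x, y). Complex x y)) (box l u) =
      emeasure (lborel \<Otimes>\<^sub>M lborel) ({Re l<..<Re u} \<times> {Im l<..<Im u})"
    by (subst emeasure_distr[OF m]) (auto simp: space_pair_measure)
  also have "\<dots> = ennreal ((Re u - Re l) * (Im u - Im l))"
    using \<open>Re l \<le> Re u\<close> \<open>Im l \<le> Im u\<close>
    by (subst lborel.emeasure_pair_measure_Times) (auto simp: ennreal_mult mult.commute)
  also have "\<dots> = (\<Prod>b\<in>Basis. (u - l) \<bullet> b)"
    by (simp add: Basis_complex_def)
  finally show "emeasure (distr (lborel \<Otimes>\<^sub>M lborel) borel (\<lambda>(x, y). Complex x y)) (box l u) =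
     (\<Prod>b\<in>Basis. (u - l) \<bullet> b)" .
qed simp

lemma lborel_complex_eq_vec:
  "(lborel :: complex measure) = distr (lborel :: (real^2) measure) borel (\<lambda>v. Complex (v $ 1) (v $ 2))"
proof (rule lborel_eqI)
  have m: "(\<lambda>v. Complex (v $ 1) (v $ 2)) \<in> borel_measurable (lborel :: (real^2) measure)"
    by (simp add: Complex_eq borel_measurable_continuous_onI continuous_intros)
  fix l u :: complex
  assume le: "\<And>b. b \<in> Basis \<Longrightarrow> l \<bullet> b \<le> u \<bullet> b"
  have le': "Re l \<le> Re u" "Im l \<le> Im u"
    using le[of 1] le[of \<i>] by (simp_all add: Basis_complex_def)
  have eq: "(\<lambda>v. Complex (v $ 1) (v $ 2)) -` box l u = box (vector [Re l, Im l]) (vector [Re u, Im u] :: real^2)"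
    by (auto simp: in_box_complex_iff mem_box_cart forall_2 vector_2)
  have "emeasure (distr (lborel :: (real^2) measure) borel (\<lambda>v. Complex (v $ 1) (v $ 2))) (box l u) =
      emeasure lborel (box (vector [Re l, Im l]) (vector [Re u, Im u] :: real^2))"
    by (subst emeasure_distr[OF m]) (auto simp: eq)
  also have "\<dots> = (\<Prod>b\<in>Basis. (vector [Re u, Im u] - vector [Re l, Im l] :: real^2) \<bullet> b)"
  proof (subst emeasure_lborel_box)
    fix b :: "real^2" assume "b \<in> Basis"
    then obtain i where "b = axis i 1" by (auto simp: Basis_vec_def)
    moreover have "(vector [Re l, Im l] :: real^2) $ i \<le> vector [Re u, Im u] $ i"
      using le' exhaust_2[of i] by (auto simp: vector_2)
    ultimately show "(vector [Re l, Im l] :: real^2) \<bullet> b \<le> vector [Re u, Im u] \<bullet> b"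
      by (simp add: cart_eq_inner_axis)
  qed simp
  also have "\<dots> = ennreal ((Re u - Re l) * (Im u - Im l))"
    by (simp add: prod_constant Basis_vec_def inner_axis' UNION_singleton_eq_range
        cart_eq_inner_axis[symmetric] UNIV_2 axis_eq_axis mult.commute)
  also have "\<dots> = (\<Prod>b\<in>Basis. (u - l) \<bullet> b)"
    by (simp add: Basis_complex_def)
  finally show "emeasure (distr (lborel :: (real^2) measure) borel (\<lambda>v. Complex (v $ 1) (v $ 2))) (box l u) =
     (\<Prod>b\<in>Basis. (u - l) \<bullet> b)" .
qed simp

text \<open>In the coordinates of \<open>real^2\<close>, multiplication by a unimodular number is an
  orthogonal transformation, and these preserve Lebesgue measure.\<close>

lemma measure_complex_rotate:
  fixes u :: complex
  assumes u: "norm u = 1" and S: "S \<in> sets borel" "bounded S"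
  shows "measure lborel ((*) u ` S) = measure lborel S"
proof -
  let ?j = "\<lambda>v::real^2. Complex (v $ 1) (v $ 2)"
  define T :: "real^2 \<Rightarrow> real^2" where
    "T v = vector [Re (u * ?j v), Im (u * ?j v)]" for v
  have m: "?j \<in> measurable lborel borel"
    by (simp add: Complex_eq borel_measurable_continuous_onI continuous_intros)
  have jT: "?j (T v) = u * ?j v" for v by (simp add: T_def vector_2 complex_eq_iff)
  have "linear T"
    by (rule linearI) (auto simp: T_def vec_eq_iff forall_2 vector_2 algebra_simps)
  moreover have "norm (T v) = norm v" for v
  proof -
    have n: "norm w = cmod (?j w)" for w :: "real^2"
      by (simp add: cmod_def norm_vec_def L2_set_def sum_2)
    show ?thesis unfolding n jT by (simp add: norm_mult u)
  qed
  ultimately have T: "orthogonal_transformation T"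
    by (simp add: orthogonal_transformation)
  have u0: "u \<noteq> 0" using u by auto
  have img: "?j -` ((*) u ` S) = T ` (?j -` S)"
  proof (intro set_eqI iffI)
    fix v assume "v \<in> ?j -` ((*) u ` S)"
    then obtain s where s: "s \<in> S" "?j v = u * s" by auto
    have "v = T (vector [Re s, Im s])"
      using s(2) by (auto simp: T_def vec_eq_iff forall_2 vector_2 complex_eq_iff)
    then show "v \<in> T ` (?j -` S)" using s(1) by (auto simp: vector_2)
  qed (auto simp: jT)
  have meas: "measure lborel A = measure lborel (?j -` A)" if "A \<in> sets borel" for A
    by (subst lborel_complex_eq_vec, subst measure_distr[OF m]) (use that in auto)
  have uS: "(*) u ` S \<in> sets borel"
  proof -
    have "(*) u ` S = (\<lambda>x. x / u) -` S"
      using u0 by (auto simp: image_iff intro!: bexI[where x = "_ / u"])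
    moreover have "(\<lambda>x. x / u) -` S \<inter> space borel \<in> sets borel"
      by (rule measurable_sets[OF _ S(1)]) (use u0 in \<open>auto intro!: borel_measurable_continuous_onI continuous_intros\<close>)
    ultimately show ?thesis by simp
  qed
  have jS: "?j -` S \<in> sets borel" using measurable_sets[OF m S(1)] by simp
  have bj: "bounded (?j -` S)"
  proof -
    obtain B where "\<forall>s\<in>S. norm s \<le> B" using S(2) bounded_iff by blast
    then show ?thesis
      unfolding bounded_iff
      by (intro exI[of _ B]) (auto simp: cmod_def norm_vec_def L2_set_def sum_2)
  qed
  have lm: "?j -` S \<in> lmeasurable"
    using bj jS by (simp add: bounded_set_imp_lmeasurable)
  have "measure lborel ((*) u ` S) = measure lborel (T ` (?j -` S))"
    by (simp add: meas[OF uS] img)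
  also have "\<dots> = measure lebesgue (T ` (?j -` S))"
  proof -
    have "T ` (?j -` S) \<in> sets borel"
      using measurable_sets[OF m uS] by (simp add: img)
    then show ?thesis by simp
  qed
  also have "\<dots> = measure lebesgue (?j -` S)"
    by (rule measure_orthogonal_image[OF T lm])
  also have "\<dots> = measure lborel S"
    using jS by (simp add: meas[OF S(1)])
  finally show ?thesis .
qed

text \<open>Fubini: the vertical slice over \<open>x\<close> in \<open>A\<close> is an interval of
  length \<open>2 * f x\<close>.\<close>

lemma emeasure_complex_between:
  fixes f :: "real \<Rightarrow> real"
  assumes f[measurable]: "f \<in> borel_measurable borel" and A[measurable]: "A \<in> sets borel"
    and f0: "\<And>x. x \<in> A \<Longrightarrow> 0 \<le> f x" and I: "(f has_integral I) A"
  shows "emeasure lborel {z. Re z \<in> A \<and> \<bar>Im z\<bar> < f (Re z)} = ennreal (2 * I)"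
proof -
  let ?X = "{z. Re z \<in> A \<and> \<bar>Im z\<bar> < f (Re z)}"
  have m: "(\<lambda>(x, y). Complex x y) \<in> measurable (lborel \<Otimes>\<^sub>M lborel) borel"
    unfolding lborel_prod by (simp add: Complex_eq split_beta borel_measurable_continuous_onI continuous_intros)
  have [measurable]: "Re \<in> borel_measurable borel" "Im \<in> borel_measurable borel"
    by (auto intro!: borel_measurable_continuous_onI continuous_intros)
  have X: "?X \<in> sets borel" by measurable
  have Y: "(\<lambda>(x, y). Complex x y) -` ?X \<in> sets (lborel \<Otimes>\<^sub>M lborel)"
    using measurable_sets[OF m X] by (simp add: space_pair_measure)
  have "emeasure lborel ?X = emeasure (lborel \<Otimes>\<^sub>M lborel) ((\<lambda>(x, y). Complex x y) -` ?X)"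
    by (subst lborel_complex_eq_pair, subst emeasure_distr[OF m X]) (simp add: space_pair_measure)
  also have "\<dots> = (\<integral>\<^sup>+x. emeasure lborel (Pair x -` ((\<lambda>(x, y). Complex x y) -` ?X)) \<partial>lborel)"
    by (rule lborel.emeasure_pair_measure_alt[OF Y])
  also have "\<dots> = (\<integral>\<^sup>+x. ennreal (indicator A x * (2 * f x)) \<partial>lborel)"
  proof (intro nn_integral_cong)
    fix x
    show "emeasure lborel (Pair x -` ((\<lambda>(x, y). Complex x y) -` ?X)) = ennreal (indicator A x * (2 * f x))"
    proof (cases "x \<in> A")
      case True
      have "Pair x -` ((\<lambda>(x, y). Complex x y) -` ?X) = {- f x<..<f x}"
        using True by auto
      with True f0[OF True] show ?thesis by simp
    qed (auto simp: vimage_def)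
  qed
  also have "\<dots> = ennreal (2 * I)"
  proof (rule nn_integral_has_integral_lborel)
    show "((\<lambda>x. indicator A x * (2 * f x)) has_integral 2 * I) UNIV"
      using has_integral_mult_right[OF I, of 2]
      unfolding has_integral_restrict_UNIV[symmetric, of _ _ A]
      by (rule has_integral_eq[rotated]) (auto simp: indicator_def)
  qed (auto simp: indicator_def f0)
  finally show ?thesis .
qed

section \<open>Circular segments compared with triangles\<close>

lemma sin_ge_chord:
  fixes a x :: real
  assumes "0 < a" "a \<le> pi" "0 \<le> x" "x \<le> a"
  shows "sin a / a * x \<le> sin x"
proof -
  have "concave_on {0..pi} sin"
  proof (rule f''_le0_imp_concave)
    fix x :: real assume "x \<in> {0..pi}"
    then show "- sin x \<le> 0" by (simp add: sin_ge_zero)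
  qed (auto intro!: derivative_eq_intros)
  then have "convex_on {0..pi} (\<lambda>x. - sin x)" by (simp add: concave_on_def)
  from convex_onD[OF this, of "x / a" 0 a] assms
  show ?thesis by (simp add: field_simps)
qed

lemma has_integral_half_disc_segment:
  fixes h :: real
  assumes h: "0 \<le> h" "h \<le> 1"
  shows "((\<lambda>x. sqrt (1 - x\<^sup>2)) has_integral (arccos h - h * sqrt (1 - h\<^sup>2)) / 2) {h..1}"
proof -
  let ?F = "\<lambda>t::real. (t * sqrt (1 - t\<^sup>2) + arcsin t) / 2"
  have "((\<lambda>x. sqrt (1 - x\<^sup>2)) has_integral (?F 1 - ?F h)) {h..1}"
  proof (rule fundamental_theorem_of_calculus_interior)
    show "continuous_on {h..1} ?F"
      using h by (intro continuous_intros) auto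
    fix x :: real assume x: "x \<in> {h<..<1}"
    have "\<bar>x\<bar> < 1" using x h by auto
    then have "x\<^sup>2 < 1" by (simp add: abs_square_less_1)
    then have pos: "0 < 1 - x\<^sup>2" by simp
    have "(?F has_real_derivative
        (sqrt (1 - x\<^sup>2) + x * (- (2 * x) * (inverse (sqrt (1 - x\<^sup>2)) / 2)) + inverse (sqrt (1 - x\<^sup>2))) / 2) (at x)"
      using x h pos by (auto intro!: derivative_eq_intros simp: power2_eq_square)
    also have "(sqrt (1 - x\<^sup>2) + x * (- (2 * x) * (inverse (sqrt (1 - x\<^sup>2)) / 2)) + inverse (sqrt (1 - x\<^sup>2))) / 2
        = (sqrt (1 - x\<^sup>2) + (1 - x\<^sup>2) / sqrt (1 - x\<^sup>2)) / 2"
      using pos by (simp add: field_simps power2_eq_square)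
    also have "\<dots> = sqrt (1 - x\<^sup>2)"
      using pos by (simp add: real_div_sqrt)
    finally show "(?F has_vector_derivative sqrt (1 - x\<^sup>2)) (at x)"
      by (simp add: has_real_derivative_iff_has_vector_derivative)
  qed (use h in auto)
  also have "?F 1 - ?F h = (arccos h - h * sqrt (1 - h\<^sup>2)) / 2"
    using h by (simp add: arccos_arcsin_eq field_simps)
  finally show ?thesis .
qed

text \<open>\<open>C\<close> is a circular segment and \<open>T\<close> the triangle with apex 0 on
  the same chord. With \<open>t = arccos h\<close> the sector they form has area \<open>t\<close>
  and \<open>T\<close> has area \<open>sin (2 * t) / 2\<close>. The ratio grows with
  \<open>t\<close>, and \<open>t\<close> is at most \<open>pi / 6\<close>, so the extreme case is a
  side of the inscribed regular hexagon, with ratio \<open>2 * pi / (3 * sqrt 3)\<close>.\<close>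

lemma cap_le_triangle_real:
  fixes h :: real
  assumes h: "sqrt 3 / 2 \<le> h" "h < 1"
  defines "C \<equiv> {z::complex. norm z < 1 \<and> h \<le> Re z}"
    and "T \<equiv> {z::complex. 0 < Re z \<and> Re z < h \<and> norm z * h < Re z}"
  shows "measure lborel C \<le> (2 * pi / (3 * sqrt 3) - 1) * measure lborel T"
proof -
  define s where "s = sqrt (1 - h\<^sup>2)"
  have h0: "0 < h" using h(1) by (rule less_le_trans[rotated]) simp
  have h2: "h\<^sup>2 < 1" using h h0 by (simp add: abs_square_less_1)
  have s: "s > 0" "s\<^sup>2 = 1 - h\<^sup>2" using h2 by (auto simp: s_def)
  have "C = {z. Re z \<in> {h..1} \<and> \<bar>Im z\<bar> < sqrt (1 - (Re z)\<^sup>2)}"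
  proof -
    have "norm z < 1 \<longleftrightarrow> Re z \<le> 1 \<and> \<bar>Im z\<bar> < sqrt (1 - (Re z)\<^sup>2)" if "h \<le> Re z" for z :: complex
    proof -
      have "norm z < 1 \<longleftrightarrow> (Re z)\<^sup>2 + (Im z)\<^sup>2 < 1" by (simp add: cmod_def)
      also have "\<dots> \<longleftrightarrow> sqrt ((Im z)\<^sup>2) < sqrt (1 - (Re z)\<^sup>2)"
        unfolding real_sqrt_less_iff by linarith
      finally have 1: "norm z < 1 \<longleftrightarrow> \<bar>Im z\<bar> < sqrt (1 - (Re z)\<^sup>2)" by simp
      have "norm z < 1 \<Longrightarrow> Re z \<le> 1" using complex_Re_le_cmod[of z] by linarith
      with 1 show ?thesis by auto
    qed
    then show ?thesis by (auto simp: C_def)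
  qed
  then have "emeasure lborel C = ennreal (2 * ((arccos h - h * s) / 2))"
    using h h0 unfolding s_def
    by (simp only:, intro emeasure_complex_between has_integral_half_disc_segment)
       (auto simp: abs_square_le_1)
  moreover have "0 \<le> arccos h - h * s"
    using has_integral_nonneg[OF has_integral_half_disc_segment, of h] h h0
    by (auto simp: s_def abs_square_le_1)
  ultimately have mC: "measure lborel C = arccos h - h * s"
    by (simp add: measure_def)
  have "T = {z. Re z \<in> {0<..<h} \<and> \<bar>Im z\<bar> < Re z * (s / h)}"
  proof -
    have "norm z * h < Re z \<longleftrightarrow> \<bar>Im z\<bar> < Re z * (s / h)" if "0 < Re z" for z :: complex
    proof -
      have "norm z * h < Re z \<longleftrightarrow> (norm z * h)\<^sup>2 < (Re z)\<^sup>2"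
        using that h0 power_mono_iff[of "Re z" "norm z * h" 2] by (auto simp flip: not_le)
      also have "\<dots> \<longleftrightarrow> (h * Im z)\<^sup>2 < (Re z * s)\<^sup>2"
        by (simp add: power_mult_distrib cmod_power2 s algebra_simps)
      also have "\<dots> \<longleftrightarrow> h * \<bar>Im z\<bar> < Re z * s"
        using that h0 s abs_le_square_iff[of "Re z * s" "h * Im z"] by (auto simp: abs_mult simp flip: not_le)
      also have "\<dots> \<longleftrightarrow> \<bar>Im z\<bar> < Re z * (s / h)"
        using h0 by (simp add: field_simps)
      finally show ?thesis .
    qed
    then show ?thesis by (auto simp: T_def)
  qed
  moreover have "((\<lambda>x. x * (s / h)) has_integral (h * s / 2)) {0<..<h}"
  proof -
    have "((\<lambda>x. x) has_integral (h\<^sup>2 / 2 - 0\<^sup>2 / 2)) {0..h}"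
      using ident_has_integral[of 0 h] h0 by simp
    from has_integral_mult_left[OF this, of "s / h"] show ?thesis
      using h0 by (simp add: has_integral_Icc_iff_Ioo power2_eq_square)
  qed
  ultimately have "emeasure lborel T = ennreal (2 * (h * s / 2))"
    using h0 s by (simp only:, intro emeasure_complex_between) auto
  then have mT: "measure lborel T = h * s"
    using h0 s by (simp add: measure_def)
  define t where "t = arccos h"
  have t: "0 \<le> t" "cos t = h" using h h0 by (auto simp: t_def arccos_lbound)
  have "t \<le> pi / 6"
  proof -
    have "t \<le> arccos (sqrt 3 / 2)"
      unfolding t_def using h h0 by (intro arccos_le_arccos) (auto intro: order.trans[of _ 0])
    also have "sqrt 3 / 2 = cos (pi / 6)" by (simp add: cos_30)
    finally show ?thesis by (simp add: arccos_cos)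
  qed
  have "sin t = s" using t \<open>t \<le> pi / 6\<close> h h0 by (simp add: t_def s_def sin_arccos)
  have "sin (pi / 3) / (pi / 3) * (2 * t) \<le> sin (2 * t)"
    using t \<open>t \<le> pi / 6\<close> by (intro sin_ge_chord) auto
  also have "\<dots> = 2 * (h * s)" by (simp add: sin_double t \<open>sin t = s\<close>)
  finally have "t \<le> 2 * pi / (3 * sqrt 3) * (h * s)"
    by (simp add: sin_60 field_simps)
  then show ?thesis by (simp add: mC mT t_def algebra_simps)
qed

text \<open>The chord lies on the perpendicular bisector of 0 and \<open>q\<close>; a rotation moves
  \<open>q\<close> to the positive real axis. If \<open>norm q\<close> is at least 2, the bisector
  misses the open disc and there is no cap. The last condition in \<open>T\<close> says that
  stretching \<open>x\<close> along its ray up to the chord keeps it inside the unit disc.\<close>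

lemma cap_le_triangle:
  fixes q :: complex
  assumes q: "sqrt 3 \<le> norm q"
  defines "C \<equiv> {x. norm x < 1 \<and> (norm q)\<^sup>2 / 2 \<le> x \<bullet> q}"
    and "T \<equiv> {x. 0 < x \<bullet> q \<and> x \<bullet> q < (norm q)\<^sup>2 / 2 \<and> norm x * (norm q)\<^sup>2 / 2 < x \<bullet> q}"
  shows "measure lborel C \<le> (2 * pi / (3 * sqrt 3) - 1) * measure lborel T"
proof (cases "norm q < 2")
  case True
  define h where "h = norm q / 2"
  define u where "u = q / norm q"
  have q0: "norm q > 0" using q by (rule less_le_trans[rotated]) simp
  then have u: "norm u = 1" "q = norm q * u" by (auto simp: u_def norm_divide)
  have u0: "u \<noteq> 0" using u by auto
  define C0 where "C0 = {z::complex. norm z < 1 \<and> h \<le> Re z}"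
  define T0 where "T0 = {z::complex. 0 < Re z \<and> Re z < h \<and> norm z * h < Re z}"
  have ip: "(u * y) \<bullet> q = norm q * Re y" for y
  proof -
    have "(u * y) \<bullet> q = (u * y) \<bullet> (norm q * u)" using u(2) by simp
    also have "\<dots> = norm q * ((Re u)\<^sup>2 + (Im u)\<^sup>2) * Re y"
      by (simp add: inner_complex_def power2_eq_square algebra_simps)
    also have "(Re u)\<^sup>2 + (Im u)\<^sup>2 = 1" using u(1) by (simp add: cmod_def)
    finally show ?thesis by simp
  qed
  have rot: "A = (*) u ` B" if AB: "\<And>y. u * y \<in> A \<longleftrightarrow> y \<in> B" for A B
  proof (intro equalityI subsetI)
    fix x assume "x \<in> A"
    with AB[of "x / u"] u0 have "x / u \<in> B" by simp
    then show "x \<in> (*) u ` B" using u0 by (intro image_eqI[of _ _ "x / u"]) auto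
  next
    fix x assume "x \<in> (*) u ` B"
    then show "x \<in> A" using AB by auto
  qed
  have "C = (*) u ` C0"
  proof (intro rot)
    fix y
    have "(norm q)\<^sup>2 / 2 \<le> norm q * Re y \<longleftrightarrow> norm q * h \<le> norm q * Re y"
      by (simp add: h_def power2_eq_square)
    then show "u * y \<in> C \<longleftrightarrow> y \<in> C0"
      using q0 by (simp add: C_def C0_def ip norm_mult u(1))
  qed
  moreover have "T = (*) u ` T0"
  proof (intro rot)
    fix y
    have "norm y * (norm q)\<^sup>2 / 2 < norm q * Re y \<longleftrightarrow> norm q * (norm y * h) < norm q * Re y"
      by (simp add: h_def power2_eq_square mult_ac)
    moreover have "norm q * Re y < (norm q)\<^sup>2 / 2 \<longleftrightarrow> norm q * Re y < norm q * h"
      by (simp add: h_def power2_eq_square)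
    ultimately show "u * y \<in> T \<longleftrightarrow> y \<in> T0"
      using q0 by (simp add: T_def T0_def ip norm_mult u(1) zero_less_mult_iff)
  qed
  moreover have "measure lborel C0 \<le> (2 * pi / (3 * sqrt 3) - 1) * measure lborel T0"
    unfolding C0_def T0_def
    by (rule cap_le_triangle_real) (use q True in \<open>auto simp: h_def\<close>)
  moreover have "C0 \<in> sets borel"
  proof -
    have "C0 = ball 0 1 \<inter> {z. h \<le> Re z}" by (auto simp: C0_def)
    moreover have "closed {z. h \<le> Re z}" by (intro closed_Collect_le continuous_intros)
    ultimately show ?thesis by auto
  qed
  moreover have "T0 \<in> sets borel"
    unfolding T0_def
    by (intro borel_open open_Collect_conj open_Collect_less continuous_intros)
  moreover have "bounded C0" unfolding bounded_iff by (auto simp: C0_def intro!: exI[of _ 1])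
  moreover have "bounded T0"
  proof -
    have "h > 0" using q0 by (simp add: h_def)
    have "norm z \<le> 1" if "z \<in> T0" for z
    proof -
      have "norm z * h < 1 * h" using that unfolding T0_def mem_Collect_eq by linarith
      then show ?thesis using \<open>h > 0\<close> by simp
    qed
    then show ?thesis unfolding bounded_iff by blast
  qed
  ultimately show ?thesis by (simp add: measure_complex_rotate u(1))
next
  case False
  have "C = {}"
  proof -
    have "x \<bullet> q < (norm q)\<^sup>2 / 2" if "norm x < 1" for x
    proof -
      have "x \<bullet> q \<le> norm x * norm q" by (rule norm_cauchy_schwarz)
      also have "\<dots> < 1 * norm q" using that False by (intro mult_strict_right_mono) auto
      also have "\<dots> \<le> (norm q)\<^sup>2 / 2" using mult_right_mono[of 2 "norm q" "norm q"] False by (auto simp: power2_eq_square)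
      finally show ?thesis .
    qed
    then show ?thesis by (force simp: C_def)
  qed
  moreover have "3 * sqrt 3 \<le> 2 * pi"
    using sin_ge_chord[of "pi/3" "pi/3"] sin_x_le_x[of "pi/3"] by (simp add: sin_60)
  then have "0 \<le> 2 * pi / (3 * sqrt 3) - 1" by (simp add: field_simps)
  ultimately show ?thesis by simp
qed


text \<open>Each point \<open>q\<close> cuts a cap off the unit disc. The caps are pairwise disjoint, since three vectors
  of norm less than 1 cannot have mutual distances at least \<open>sqrt 3\<close>; hence the triangles spanned by 0
  and their chords are disjoint and lie in the cell, and \<open>cap_le_triangle\<close> bounds the total area lost.\<close>
lemma truncated_voronoi_area:
  fixes D :: "complex set"
  assumes fin: "finite D" and D: "\<And>q. q \<in> D \<Longrightarrow> sqrt 3 \<le> norm q"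
    and sep: "\<And>q q'. q \<in> D \<Longrightarrow> q' \<in> D \<Longrightarrow> q \<noteq> q' \<Longrightarrow> sqrt 3 \<le> norm (q - q')"
  shows "3 * sqrt 3 / 2 \<le> measure lborel {x. norm x < 1 \<and> (\<forall>q\<in>D. x \<bullet> q < (norm q)\<^sup>2 / 2)}"
proof -
  define V where "V = {x. norm x < 1 \<and> (\<forall>q\<in>D. x \<bullet> q < (norm q)\<^sup>2 / 2)}"
  define C where "C q = {x. norm x < 1 \<and> (norm q)\<^sup>2 / 2 \<le> x \<bullet> q}" for q :: complex
  define T where "T q = {x. 0 < x \<bullet> q \<and> x \<bullet> q < (norm q)\<^sup>2 / 2 \<and> norm x * (norm q)\<^sup>2 / 2 < x \<bullet> q}"
    for q :: complex
  define \<kappa> where "\<kappa> = 2 * pi / (3 * sqrt 3) - 1"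
  have q3: "3 \<le> (norm q)\<^sup>2" if "q \<in> D" for q
    using D[OF that] by (simp add: real_le_rsqrt sqrt_le_D)
  have caps: "q = q'" if "y \<in> C q" "y \<in> C q'" "q \<in> D" "q' \<in> D" for y q q'
  proof (rule ccontr)
    assume ne: "q \<noteq> q'"
    have "norm y < 1" "(norm q)\<^sup>2 / 2 \<le> y \<bullet> q" "(norm q')\<^sup>2 / 2 \<le> y \<bullet> q'"
      using that by (auto simp: C_def)
    moreover have "(norm y)\<^sup>2 < 1" using \<open>norm y < 1\<close> by (simp add: abs_square_less_1)
    moreover have "3 \<le> (norm (q - q'))\<^sup>2"
      using sep[OF that(3,4) ne] by (simp add: real_le_rsqrt sqrt_le_D)
    moreover note q3[OF that(3)] q3[OF that(4)]
    \<comment> \<open>Three times the sum of the squared norms of the vectors \<open>y\<close>,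
      \<open>y - q\<close>, \<open>y - q'\<close> is the squared norm of their sum plus the three
      squared distances. Inserting the two cap inequalities, the right side is at least \<open>(norm
      q)\<^sup>2 + (norm q')\<^sup>2 + (norm (q - q'))\<^sup>2\<close>, hence at least 9.\<close>
    moreover have "9 * (norm y)\<^sup>2 = (norm (y + (y - q) + (y - q')))\<^sup>2 + 6 * (y \<bullet> q) + 6 * (y \<bullet> q')
        - 2 * (norm q)\<^sup>2 - 2 * (norm q')\<^sup>2 + (norm (q - q'))\<^sup>2"
      by (simp only: power2_norm_eq_inner inner_diff_left inner_diff_right inner_add_left inner_add_right)
        (simp add: inner_commute)
    moreover have "0 \<le> (norm (y + (y - q) + (y - q')))\<^sup>2" by simp
    ultimately show False by argo
  qed
  \<comment> \<open>A point of a triangle is pushed outward along its ray to the chord, into the cap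
    of \<open>q\<close>; if a second triangle is involved, the larger of the two stretching factors
    is used. Stretching never leaves a cap while the norm stays below 1. Overlaps involving a
    triangle thus become overlaps of caps, which \<open>caps\<close> excludes for distinct
    points.\<close>
  have TT: "(\<forall>q'. x \<in> C q' \<longrightarrow> (\<exists>y. y \<in> C q \<and> y \<in> C q'))
      \<and> (\<forall>q'. x \<in> T q' \<longrightarrow> (\<exists>y. y \<in> C q \<and> y \<in> C q'))" if "x \<in> T q" for x q
  proof -
    define s where "s q = (norm q)\<^sup>2 / 2 / (x \<bullet> q)" for q
    have s: "1 < s q \<and> norm (s q *\<^sub>R x) < 1 \<and> (s q *\<^sub>R x) \<bullet> q = (norm q)\<^sup>2 / 2 \<and> 0 < x \<bullet> q"
      if "x \<in> T q" for q
      using that by (auto simp: T_def s_def field_simps abs_mult)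
    have sC: "t *\<^sub>R x \<in> C q'" if "norm (t *\<^sub>R x) < 1" "x \<in> T q'" "s q' \<le> t" for t q'
    proof -
      have "s q' * (x \<bullet> q') \<le> t * (x \<bullet> q')"
        using that s[OF that(2)] by (intro mult_right_mono) auto
      then have "(norm q')\<^sup>2 / 2 \<le> t * (x \<bullet> q')"
        using s[OF that(2)] unfolding inner_scaleR_left by linarith
      then show ?thesis using that by (simp add: C_def)
    qed
    have sC': "t *\<^sub>R x \<in> C q'" if "norm (t *\<^sub>R x) < 1" "x \<in> C q'" "1 \<le> t" for t q'
    proof -
      have "0 \<le> x \<bullet> q'" using that(2) zero_le_power2[of "norm q'"] unfolding C_def mem_Collect_eq by linarith
      then have "1 * (x \<bullet> q') \<le> t * (x \<bullet> q')"
        using that by (intro mult_right_mono) auto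
      then show ?thesis using that by (simp add: C_def)
    qed
    show ?thesis
    proof (intro conjI allI impI)
      fix q' assume "x \<in> C q'"
      then show "\<exists>y. y \<in> C q \<and> y \<in> C q'"
        using s[OF that] sC[of "s q" q] sC'[of "s q" q'] that by (intro exI[of _ "s q *\<^sub>R x"]) auto
    next
      fix q' assume q': "x \<in> T q'"
      have "norm (max (s q) (s q') *\<^sub>R x) < 1"
        using s[OF that] s[OF q'] by (auto simp: max_def)
      then show "\<exists>y. y \<in> C q \<and> y \<in> C q'"
        using sC[OF _ that] sC[OF _ q'] by (intro exI[of _ "max (s q) (s q') *\<^sub>R x"]) auto
    qed
  qed
  have TV: "T q \<subseteq> V" if "q \<in> D" for q
  proof
    fix x assume x: "x \<in> T q"
    have "norm x < 1"
    proof -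
      have "norm x * ((norm q)\<^sup>2 / 2) < 1 * ((norm q)\<^sup>2 / 2)" using x by (auto simp: T_def)
      then show ?thesis using q3[OF that] by (subst (asm) mult_less_cancel_right) auto
    qed
    moreover have "x \<bullet> q' < (norm q')\<^sup>2 / 2" if "q' \<in> D" for q'
    proof (rule ccontr)
      assume "\<not> x \<bullet> q' < (norm q')\<^sup>2 / 2"
      then have "x \<in> C q'" using \<open>norm x < 1\<close> by (auto simp: C_def)
      with TT[OF x] caps \<open>q \<in> D\<close> \<open>q' \<in> D\<close> have "q' = q" by metis
      with \<open>x \<in> C q'\<close> x show False by (auto simp: C_def T_def)
    qed
    ultimately show "x \<in> V" by (simp add: V_def)
  qed
  have disj: "disjoint_family_on T D"
    unfolding disjoint_family_on_def using TT caps by (metis disjoint_iff)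
  have oT: "open (T q)" for q
    unfolding T_def by (intro open_Collect_conj open_Collect_less continuous_intros) auto
  have "V = ball 0 1 \<inter> (\<Inter>q\<in>D. {x. x \<bullet> q < (norm q)\<^sup>2 / 2})" by (auto simp: V_def)
  then have oV: "open V"
    using fin by (auto intro!: open_Int open_INT open_Collect_less continuous_intros)
  have bV: "V \<subseteq> ball 0 1" by (auto simp: V_def)
  have "C q = ball 0 1 \<inter> {x. (norm q)\<^sup>2 / 2 \<le> x \<bullet> q}" for q by (auto simp: C_def)
  moreover have "closed {x. (norm q)\<^sup>2 / 2 \<le> x \<bullet> q}" for q :: complex
    by (intro closed_Collect_le continuous_intros)
  ultimately have sC: "C q \<in> sets borel" for q by auto
  have fm: "A \<in> fmeasurable lborel" if "A \<in> sets borel" "A \<subseteq> ball 0 1" for A :: "complex set"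
    by (rule fmeasurableI2[of "ball 0 1"])
      (use that emeasure_lborel_ball_finite[of "0::complex" 1] in \<open>auto simp: fmeasurable_def\<close>)
  have fV: "V \<in> fmeasurable lborel" using oV bV by (intro fm) auto
  have fC: "C q \<in> fmeasurable lborel" for q using sC by (intro fm) (auto simp: C_def)
  have fT: "T q \<in> fmeasurable lborel" if "q \<in> D" for q
    using oT TV[OF that] bV by (intro fm) auto
  \<comment> \<open>\<open>V\<close> and the caps cover the disc, and the caps cost at most \<kappa>
    times triangles that are disjoint and lie in \<open>V\<close>. So \<open>pi\<close> is at most
    \<open>(1 + \<kappa>)\<close> times the area of \<open>V\<close>, where
    \<open>1 + \<kappa>\<close> is the ratio of the disc to the inscribed regular hexagon.\<close>
  have "pi = measure lborel (ball 0 1 :: complex set)"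
    using content_ball[of 1 "0::complex"] by (simp add: unit_ball_vol_2)
  also have "\<dots> \<le> measure lborel (V \<union> (\<Union>q\<in>D. C q))"
    by (rule measure_mono_fmeasurable) (use fV fC fin in \<open>auto simp: V_def C_def not_less\<close>)
  also have "\<dots> \<le> measure lborel V + measure lborel (\<Union>q\<in>D. C q)"
    using oV sC fin by (intro measure_Un_le) (auto intro!: sets.finite_UN)
  also have "measure lborel (\<Union>q\<in>D. C q) \<le> (\<Sum>q\<in>D. measure lborel (C q))"
    using sC fin by (intro measure_UNION_le) auto
  also have "\<dots> \<le> (\<Sum>q\<in>D. \<kappa> * measure lborel (T q))"
    unfolding C_def T_def \<kappa>_def by (intro sum_mono cap_le_triangle D)
  also have "\<dots> = \<kappa> * measure lborel (\<Union>q\<in>D. T q)"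
  proof -
    have "measure lborel (\<Union>q\<in>D. T q) = (\<Sum>q\<in>D. measure lborel (T q))"
      using fT disj fin
      by (intro measure_UNION_AE) (auto simp: disjoint_family_on_def pairwise_def fmeasurable_def disjnt_def intro!: AE_I2)
    then show ?thesis by (simp add: sum_distrib_left)
  qed
  also have "\<kappa> * measure lborel (\<Union>q\<in>D. T q) \<le> \<kappa> * measure lborel V"
  proof (rule mult_left_mono)
    have "3 * sqrt 3 \<le> 2 * pi"
      using sin_ge_chord[of "pi/3" "pi/3"] sin_x_le_x[of "pi/3"] by (simp add: sin_60)
    then show "0 \<le> \<kappa>" by (simp add: \<kappa>_def field_simps)
    show "measure lborel (\<Union>q\<in>D. T q) \<le> measure lborel V"
      using TV fV oT by (intro measure_mono_fmeasurable) (auto intro!: borel_open)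
  qed
  finally have "pi \<le> 2 * pi / (3 * sqrt 3) * measure lborel V"
    by (simp add: \<kappa>_def algebra_simps)
  then have "3 * sqrt 3 / 2 \<le> measure lborel V"
    by (simp add: field_simps)
  then show ?thesis by (simp add: V_def)
qed

text \<open>\<open>W p\<close> is the Voronoi cell of \<open>p\<close> truncated to the unit disc
  about \<open>p\<close>. Truncation keeps the cells of border points within distance 1 of the
  square, and each still has area at least \<open>3 * sqrt 3 / 2\<close>, the cell area of the
  hexagonal lattice with minimal distance \<open>sqrt 3\<close>.\<close>

lemma packing_square_normalized:
  fixes S :: "complex set"
  assumes fin: "finite S" and l: "0 \<le> l"
    and S: "\<And>w. w \<in> S \<Longrightarrow> a \<le> Re w \<and> Re w \<le> a + l \<and> b \<le> Im w \<and> Im w \<le> b + l"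
    and sep: "\<And>q q'. q \<in> S \<Longrightarrow> q' \<in> S \<Longrightarrow> q \<noteq> q' \<Longrightarrow> sqrt 3 \<le> norm (q - q')"
  shows "real (card S) * (3 * sqrt 3 / 2) \<le> (l + 2)\<^sup>2"
proof -
  define D where "D p = (\<lambda>q. q - p) ` (S - {p})" for p
  define V where "V p = {x. norm x < 1 \<and> (\<forall>q\<in>D p. x \<bullet> q < (norm q)\<^sup>2 / 2)}" for p
  define W where "W p = (+) p ` V p" for p
  define Q where "Q = box (Complex (a - 1) (b - 1)) (Complex (a + l + 1) (b + l + 1))"
  have "V p = ball 0 1 \<inter> (\<Inter>q\<in>D p. {x. x \<bullet> q < (norm q)\<^sup>2 / 2})" for p by (auto simp: V_def)
  then have "open (V p)" for p
    using fin by (auto simp: D_def intro!: open_Int open_INT open_Collect_less continuous_intros)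
  then have oW: "open (W p)" for p by (simp add: W_def open_translation)
  have mV: "3 * sqrt 3 / 2 \<le> measure lborel (W p)" if "p \<in> S" for p
  proof -
    have "3 * sqrt 3 / 2 \<le> measure lborel (V p)"
      unfolding V_def using fin sep that by (intro truncated_voronoi_area) (auto simp: D_def)
    also have "measure lborel (V p) = measure lborel (W p)"
      unfolding W_def using measure_translation[of p "V p"] \<open>open (V p)\<close> oW[of p] by (simp add: W_def)
    finally show ?thesis .
  qed
  have WQ: "W p \<subseteq> Q" if "p \<in> S" for p
  proof
    fix x assume "x \<in> W p"
    then have "norm (x - p) < 1" by (auto simp: W_def V_def)
    then have "\<bar>Re x - Re p\<bar> < 1" "\<bar>Im x - Im p\<bar> < 1"
      using abs_Re_le_cmod[of "x - p"] abs_Im_le_cmod[of "x - p"] by auto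
    then show "x \<in> Q" using S[OF that] by (auto simp: Q_def in_box_complex_iff)
  qed
  have fQ: "Q \<in> fmeasurable lborel"
    using emeasure_lborel_box_finite[of "Complex (a - 1) (b - 1)" "Complex (a + l + 1) (b + l + 1)"]
    by (auto simp: Q_def fmeasurable_def)
  have disj: "W p \<inter> W q = {}" if "p \<in> S" "q \<in> S" "p \<noteq> q" for p q
  proof (rule ccontr)
    assume "W p \<inter> W q \<noteq> {}"
    then obtain x where x: "x \<in> W p" "x \<in> W q" by auto
    have "(x - p) \<bullet> (q - p) < (norm (q - p))\<^sup>2 / 2"
      using x(1) that by (auto simp: W_def V_def D_def)
    moreover have "(x - q) \<bullet> (p - q) < (norm (p - q))\<^sup>2 / 2"
      using x(2) that by (auto simp: W_def V_def D_def)
    moreover have "(x - p) \<bullet> (q - p) + (x - q) \<bullet> (p - q) = (norm (q - p))\<^sup>2"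
      by (simp add: power2_norm_eq_inner inner_simps inner_commute algebra_simps)
    ultimately show False by (simp add: norm_minus_commute)
  qed
  have "real (card S) * (3 * sqrt 3 / 2) \<le> (\<Sum>p\<in>S. measure lborel (W p))"
    using sum_mono[of S "\<lambda>_. 3 * sqrt 3 / 2", OF mV] by simp
  also have "\<dots> = measure lborel (\<Union>p\<in>S. W p)"
    using fin disj oW fmeasurableI2[OF fQ WQ]
    by (intro measure_UNION_AE[symmetric]) (auto simp: pairwise_def fmeasurable_def disjnt_def intro!: AE_I2)
  also have "\<dots> \<le> measure lborel Q"
    using WQ oW fQ by (intro measure_mono_fmeasurable) (auto intro!: borel_open)
  also have "\<dots> = (l + 2)\<^sup>2"
    unfolding Q_def using l
    by (subst measure_lborel_box_eq) (auto simp: Basis_complex_def power2_eq_square algebra_simps)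
  finally show ?thesis .
qed

text \<open>Dilation by \<open>sqrt 3 / \<delta>\<close>; the summand
  \<open>2 * \<delta> / sqrt 3\<close> is the border of width 1 on both sides, scaled back.\<close>

lemma packing_square:
  fixes S :: "complex set"
  assumes fin: "finite S" and l: "0 \<le> l" and \<delta>: "0 < \<delta>"
    and S: "\<And>w. w \<in> S \<Longrightarrow> a \<le> Re w \<and> Re w \<le> a + l \<and> b \<le> Im w \<and> Im w \<le> b + l"
    and sep: "\<And>q q'. q \<in> S \<Longrightarrow> q' \<in> S \<Longrightarrow> q \<noteq> q' \<Longrightarrow> \<delta> \<le> norm (q - q')"
  shows "real (card S) * (sqrt 3 / 2 * \<delta>\<^sup>2) \<le> (l + 2 * \<delta> / sqrt 3)\<^sup>2"
proof -
  define c where "c = sqrt 3 / \<delta>"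
  have c: "c > 0" using \<delta> by (simp add: c_def)
  let ?m = "\<lambda>w::complex. of_real c * w"
  have inj: "inj_on ?m S" using c by (auto simp: inj_on_def)
  have "real (card (?m ` S)) * (3 * sqrt 3 / 2) \<le> (c * l + 2)\<^sup>2"
  proof (rule packing_square_normalized)
    show "c * a \<le> Re w \<and> Re w \<le> c * a + c * l \<and> c * b \<le> Im w \<and> Im w \<le> c * b + c * l"
      if w: "w \<in> ?m ` S" for w
      using w S c by (auto simp flip: distrib_left)
    show "sqrt 3 \<le> norm (q - q')" if qq: "q \<in> ?m ` S" "q' \<in> ?m ` S" "q \<noteq> q'" for q q'
    proof -
      obtain u v where uv: "q = ?m u" "q' = ?m v" "u \<in> S" "v \<in> S" "u \<noteq> v" using qq by blast
      have "c * \<delta> \<le> c * norm (u - v)" using sep uv c by auto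
      moreover have "c * \<delta> = sqrt 3" using \<delta> by (simp add: c_def)
      moreover have "norm (q - q') = c * norm (u - v)"
        using uv c by (simp add: norm_mult flip: right_diff_distrib)
      ultimately show ?thesis by simp
    qed
  qed (use fin l c in auto)
  then have "(real (card S) * (3 * sqrt 3 / 2)) * (\<delta>\<^sup>2 / 3) \<le> (c * l + 2)\<^sup>2 * (\<delta>\<^sup>2 / 3)"
    by (intro mult_right_mono) (simp_all add: card_image[OF inj])
  also have "(c * l + 2)\<^sup>2 * (\<delta>\<^sup>2 / 3) = ((c * l + 2) * (\<delta> / sqrt 3))\<^sup>2"
    by (simp add: power_mult_distrib power_divide)
  also have "(c * l + 2) * (\<delta> / sqrt 3) = l + 2 * \<delta> / sqrt 3"
    using \<delta> by (simp add: c_def field_simps)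
  finally show ?thesis by (simp add: field_simps)
qed

subsection \<open>A quasi-periodic entire function\<close>

definition theta_coeff :: "nat \<Rightarrow> complex" where
  "theta_coeff n = of_real (exp (- pi * (real n)\<^sup>2))"

definition theta_half :: "complex \<Rightarrow> complex" where
  "theta_half w = (\<Sum>n. theta_coeff n * w ^ n)"

text \<open>With \<open>w = exp (2 * pi * \<i> * z)\<close> this is Jacobi's theta series for the
  square lattice, the sum of \<open>exp (- pi * n\<^sup>2) * w ^ n\<close> over all integers
  \<open>n\<close>. The subtracted 1 is the term \<open>n = 0\<close>, which both halves
  contain.\<close>

definition theta :: "complex \<Rightarrow> complex" where
  "theta w = theta_half w + theta_half (1 / w) - 1"

lemma summable_theta: "summable (\<lambda>n. theta_coeff n * w ^ n)"
proof (rule summable_comparison_test_ev)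
  have "(\<lambda>n. exp (- pi * real n) * norm w) \<longlonglongrightarrow> 0"
    by real_asymp
  then have "eventually (\<lambda>n. exp (- pi * real n) * norm w < 1/2) sequentially"
    by (rule order_tendstoD) simp
  then show "eventually (\<lambda>n. norm (theta_coeff n * w ^ n) \<le> (1/2) ^ n) sequentially"
  proof eventually_elim
    case (elim n)
    have "norm (theta_coeff n) = exp (- pi * (real n)\<^sup>2)"
      by (simp add: theta_coeff_def)
    also have "\<dots> = exp (- pi * real n) ^ n"
      unfolding exp_of_nat_mult[symmetric] by (simp add: power2_eq_square mult_ac)
    finally have "norm (theta_coeff n * w ^ n) = (exp (- pi * real n) * norm w) ^ n"
      by (simp add: norm_mult norm_power power_mult_distrib)
    also have "\<dots> \<le> (1/2) ^ n" using elim by (intro power_mono) auto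
    finally show ?case .
  qed
qed (simp add: summable_geometric)

lemma holomorphic_theta_half: "theta_half holomorphic_on UNIV"
proof -
  have "\<exists>D. DERIV theta_half w :> D" for w
    using termdiffs_strong_converges_everywhere[of theta_coeff w, OF summable_theta]
    by (auto simp: theta_half_def[abs_def])
  then show ?thesis
    by (auto simp: holomorphic_on_open)
qed

text \<open>Expanding \<open>(n + 1)\<^sup>2\<close> in the exponent shifts the index of the series;
  the initial term is left over as the -1.\<close>

lemma theta_half_shift:
  "exp (- of_real pi) * w * theta_half (exp (- 2 * of_real pi) * w) = theta_half w - 1"
proof -
  have "theta_half w - theta_coeff 0 * w ^ 0 = (\<Sum>n. theta_coeff (Suc n) * w ^ Suc n)"
    unfolding theta_half_def using suminf_split_head[OF summable_theta, of w] by simp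
  also have "\<dots> = (\<Sum>n. exp (- of_real pi) * w * (theta_coeff n * (exp (- 2 * of_real pi) * w) ^ n))"
  proof (rule suminf_cong)
    fix n
    have "exp (- pi * (real (Suc n))\<^sup>2) = exp (- pi) * exp (- pi * (real n)\<^sup>2) * exp (- 2 * pi) ^ n"
      unfolding exp_of_nat_mult[symmetric] exp_add[symmetric] by (simp add: algebra_simps power2_eq_square)
    then have "theta_coeff (Suc n) = exp (- of_real pi) * theta_coeff n * exp (- 2 * of_real pi) ^ n"
      by (simp add: theta_coeff_def flip: exp_of_real)
    then show "theta_coeff (Suc n) * w ^ Suc n =
      exp (- of_real pi) * w * (theta_coeff n * (exp (- 2 * of_real pi) * w) ^ n)"
      by (simp add: power_mult_distrib)
  qed
  also have "\<dots> = exp (- of_real pi) * w * theta_half (exp (- 2 * of_real pi) * w)"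
    unfolding theta_half_def by (rule suminf_mult[OF summable_theta])
  finally show ?thesis by (simp add: theta_coeff_def)
qed

text \<open>The half series is shifted at \<open>w\<close> and at
  \<open>1 / (exp (- 2 * of_real pi) * w)\<close>; the two leftover terms cancel against the -1 in
  \<open>theta\<close>.\<close>

lemma theta_shift:
  assumes "w \<noteq> 0"
  shows "theta (exp (- 2 * of_real pi) * w) = theta w / (exp (- of_real pi) * w)"
proof -
  define q :: complex where "q = exp (- of_real pi)"
  have q: "q \<noteq> 0" "exp (- 2 * of_real pi) = q\<^sup>2"
    by (simp_all add: q_def power2_eq_square flip: exp_add)
  have 1: "q * w * theta_half (q\<^sup>2 * w) = theta_half w - 1"
    using theta_half_shift[of w] unfolding q(2) by (simp flip: q_def)
  have 2: "q * (1 / (q\<^sup>2 * w)) * theta_half (q\<^sup>2 * (1 / (q\<^sup>2 * w))) = theta_half (1 / (q\<^sup>2 * w)) - 1"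
    using theta_half_shift[of "1 / (q\<^sup>2 * w)"] unfolding q(2) by (simp flip: q_def)
  have "q * w * theta (q\<^sup>2 * w) = theta w"
  proof -
    have "q * w * theta_half (1 / (q\<^sup>2 * w)) = theta_half (1 / w) + q * w"
      using 2 q(1) assms by (simp add: field_simps power2_eq_square)
    then show ?thesis using 1 by (simp add: theta_def algebra_simps)
  qed
  then show ?thesis unfolding q(2) using q(1) assms by (simp add: field_simps flip: q_def)
qed

text \<open>All coefficients are positive and the constant one is 1, so \<open>theta_half 1\<close>
  has real part at least 1 and cannot be one half.\<close>

lemma theta_1_nonzero: "theta 1 \<noteq> 0"
proof
  assume "theta 1 = 0"
  then have "2 * theta_half 1 = 1" by (simp add: theta_def)
  moreover have "1 \<le> Re (theta_half 1)"
  proof -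
    have s: "summable (\<lambda>n. theta_coeff n)" using summable_theta[of 1] by simp
    have r: "Re (theta_coeff n) = exp (- pi * (real n)\<^sup>2)" for n
      by (simp add: theta_coeff_def)
    have "(\<Sum>n<1. Re (theta_coeff n)) \<le> (\<Sum>n. Re (theta_coeff n))"
      by (rule sum_le_suminf[OF summable_Re[OF s]]) (simp_all add: r)
    also have "\<dots> = Re (theta_half 1)"
      using bounded_linear.suminf[OF bounded_linear_Re s] by (simp add: theta_half_def)
    finally show ?thesis by (simp add: theta_coeff_def)
  qed
  moreover have "2 * Re (theta_half 1) = Re (2 * theta_half 1)" by simp
  ultimately show False by simp
qed

text \<open>At this point multiplication by \<open>exp (- 2 * of_real pi)\<close> agrees with
  inversion, under which \<open>theta\<close> is invariant, while the multiplier in the shift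
  formula is -1.\<close>

lemma theta_zero: "theta (- exp (of_real pi)) = 0"
proof -
  let ?w = "- exp (of_real pi) :: complex"
  have e: "exp (- of_real pi) * exp (of_real pi) = (1::complex)" by (simp flip: exp_add)
  have "exp (- 2 * of_real pi) * ?w = - exp (- of_real pi)"
    by (simp flip: exp_add)
  then have "exp (- 2 * of_real pi) * ?w = 1 / ?w"
    by (simp add: exp_minus inverse_eq_divide)
  moreover have "theta (1 / ?w) = theta ?w" by (simp add: theta_def)
  ultimately have "theta ?w = theta ?w / (exp (- of_real pi) * ?w)"
    using theta_shift[of ?w] by simp
  then show ?thesis using e by simp
qed

text \<open>The Gaussian factor makes \<open>\<lambda>z. norm (gsigma z) * exp (- pi / 2 * (norm z)\<^sup>2)\<close> doubly
  periodic; \<open>gsigma\<close> plays the role of the Weierstrass sigma function of the Gaussian integers, moved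
  so that its zeros lie at the centres of the unit cells.\<close>
definition gsigma :: "complex \<Rightarrow> complex" where
  "gsigma z = theta (exp (2 * of_real pi * \<i> * z)) * exp (of_real pi / 2 * z\<^sup>2)"

lemma holomorphic_gsigma: "gsigma holomorphic_on A"
proof -
  have th: "(\<lambda>z. theta_half (g z)) holomorphic_on UNIV" if "g holomorphic_on UNIV" for g
    using holomorphic_on_compose_gen[OF that holomorphic_theta_half] by (simp add: o_def)
  have "gsigma = (\<lambda>z. (theta_half (exp (2 * of_real pi * \<i> * z)) + theta_half (1 / exp (2 * of_real pi * \<i> * z)) - 1)
      * exp (of_real pi / 2 * z\<^sup>2))"
    by (simp add: fun_eq_iff gsigma_def theta_def)
  moreover have "\<dots> holomorphic_on UNIV"
    by (intro holomorphic_on_mult holomorphic_on_diff holomorphic_on_add th) (intro holomorphic_intros; simp)+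
  ultimately have "gsigma holomorphic_on UNIV" by simp
  then show ?thesis by (rule holomorphic_on_subset) simp
qed

definition gsigma_weight :: "complex \<Rightarrow> real" where
  "gsigma_weight z = norm (gsigma z) * exp (- pi / 2 * (norm z)\<^sup>2)"

lemma gsigma_weight_add_1: "gsigma_weight (z + 1) = gsigma_weight z"
proof -
  have "exp (2 * of_real pi * \<i> * (z + 1)) = exp (2 * of_real pi * \<i> * z)"
    using exp_two_pi_i by (simp add: distrib_left exp_add mult_ac)
  moreover have "norm (exp (of_real pi / 2 * (z + 1)\<^sup>2)) * exp (- pi / 2 * (norm (z + 1))\<^sup>2) =
     norm (exp (of_real pi / 2 * z\<^sup>2)) * exp (- pi / 2 * (norm z)\<^sup>2)"
    by (simp add: norm_exp_eq_Re cmod_power2 flip: exp_add) (simp add: power2_eq_square field_simps)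
  ultimately show ?thesis
    by (simp add: gsigma_weight_def gsigma_def norm_mult)
qed

lemma gsigma_weight_add_i: "gsigma_weight (z + \<i>) = gsigma_weight z"
proof -
  let ?w = "exp (2 * of_real pi * \<i> * z)"
  have eq: "exp (2 * of_real pi * \<i> * (z + \<i>)) = exp (- 2 * of_real pi) * ?w"
    by (simp add: algebra_simps flip: exp_add)
  have "norm (theta ?w / (exp (- of_real pi) * ?w)) = norm (theta ?w) / (exp (- pi) * exp (- (2 * pi * Im z)))"
    by (simp add: norm_divide norm_mult)
  also have "\<dots> = norm (theta ?w) * exp (pi + 2 * pi * Im z)"
    by (simp add: exp_minus exp_add field_simps)
  finally have "norm (theta (exp (2 * of_real pi * \<i> * (z + \<i>)))) = norm (theta ?w) * exp (pi + 2 * pi * Im z)"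
    by (simp only: eq theta_shift[OF exp_not_eq_zero])
  \<comment> \<open>The factor \<open>exp (of_real pi / 2 * z\<^sup>2)\<close> times the Gaussian
    has modulus \<open>exp (- pi * (Im z)\<^sup>2)\<close>, which balances the multiplier of the
    theta shift exactly.\<close>
  moreover have "exp (pi + 2 * pi * Im z) * norm (exp (of_real pi / 2 * (z + \<i>)\<^sup>2)) * exp (- pi / 2 * (norm (z + \<i>))\<^sup>2) =
     norm (exp (of_real pi / 2 * z\<^sup>2)) * exp (- pi / 2 * (norm z)\<^sup>2)"
    by (simp add: norm_exp_eq_Re cmod_power2 flip: exp_add) (simp add: power2_eq_square field_simps)
  ultimately show ?thesis
    by (simp add: gsigma_weight_def gsigma_def norm_mult mult_ac)
qed

lemma periodic_of_int:
  fixes f :: "complex \<Rightarrow> 'b"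
  assumes per: "\<And>z. f (z + p) = f z"
  shows "f (z + of_int n * p) = f z"
proof (induction n rule: int_induct[where k = 0])
  case (step1 i)
  then show ?case using per[of "z + of_int i * p"] by (simp add: algebra_simps)
next
  case (step2 i)
  then show ?case using per[of "z + of_int (i - 1) * p"] by (simp add: algebra_simps)
qed simp

lemma gsigma_weight_periodic: "gsigma_weight (z + Complex (of_int a) (of_int b)) = gsigma_weight z"
  using periodic_of_int[of gsigma_weight 1 z a, OF gsigma_weight_add_1]
    periodic_of_int[of gsigma_weight \<i> "z + of_int a" b, OF gsigma_weight_add_i]
  by (simp add: Complex_eq algebra_simps)

lemma continuous_gsigma_weight: "continuous_on A gsigma_weight"
  unfolding gsigma_weight_def[abs_def]
  by (intro continuous_intros holomorphic_on_imp_continuous_on holomorphic_gsigma)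

text \<open>Periodicity reduces the first estimate to one closed cell and the second to a
  neighbourhood of one zero. The second, linear in the distance to the zero, will cancel the
  denominator \<open>(z - c) ^ K\<close> in the cell that contains \<open>z\<close>.\<close>

lemma gsigma_bounds:
  obtains C where "C > 0" "\<And>z. norm (gsigma z) \<le> C * exp (pi / 2 * (norm z)\<^sup>2)"
    "\<And>z a b. norm (gsigma z) \<le>
        C * norm (z - Complex (of_int a + 1/2) (of_int b + 1/2)) * exp (pi / 2 * (norm z)\<^sup>2)"
proof -
  \<comment> \<open>Chosen so that \<open>exp (2 * of_real pi * \<i> * c0)\<close> is the known zero
    of \<open>theta\<close>. The imaginary part -1/2 is why the shift below is by
    \<open>- b - 1\<close>.\<close>
  define c0 where "c0 = Complex (1/2) (- 1/2)"
  have z0: "gsigma c0 = 0"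
  proof -
    have "exp (2 * of_real pi * \<i> * c0) = - exp (of_real pi)"
      by (simp add: c0_def exp_eq_polar cis.ctr complex_eq_iff Re_exp Im_exp)
    then show ?thesis by (simp add: gsigma_def theta_zero)
  qed
  obtain C1 where C1: "\<And>z. z \<in> cbox 0 (Complex 1 1) \<Longrightarrow> gsigma_weight z \<le> C1"
    using continuous_attains_sup[OF compact_cbox, of 0 "Complex 1 1" gsigma_weight] continuous_gsigma_weight
    by (metis (no_types) empty_iff)
  have C1': "gsigma_weight z \<le> C1" for z
  proof -
    have "gsigma_weight z = gsigma_weight (z + Complex (of_int (- \<lfloor>Re z\<rfloor>)) (of_int (- \<lfloor>Im z\<rfloor>)))"
      by (rule gsigma_weight_periodic[symmetric])
    also have "\<dots> \<le> C1"
      by (rule C1) (auto simp: in_cbox_complex_iff intro: less_imp_le real_of_int_floor_add_one_gt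
          simp: add.commute, linarith+)
    finally show ?thesis .
  qed
  have "continuous_on (cball c0 1) (deriv gsigma)"
    by (intro holomorphic_on_imp_continuous_on holomorphic_on_subset[OF holomorphic_deriv[OF holomorphic_gsigma, of UNIV]]) auto
  then have "bounded (deriv gsigma ` cball c0 1)"
    by (intro compact_imp_bounded compact_continuous_image) auto
  then obtain B where "\<forall>x\<in>deriv gsigma ` cball c0 1. norm x \<le> B"
    unfolding bounded_iff by blast
  then have B: "norm (deriv gsigma z) \<le> B" if "z \<in> cball c0 1" for z
    using that by blast
  have lip: "norm (gsigma z) \<le> B * norm (z - c0)" if "z \<in> cball c0 1" for z
  proof -
    have "norm (gsigma z - gsigma c0) \<le> B * norm (z - c0)"
    proof (rule field_differentiable_bound[of "cball c0 1"])
      show "(gsigma has_field_derivative deriv gsigma z) (at z within cball c0 1)" for z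
        using holomorphic_derivI[OF holomorphic_gsigma, of UNIV z] has_field_derivative_at_within by blast
    qed (use B that in auto)
    then show ?thesis by (simp add: z0)
  qed
  define C where "C = max 1 (max C1 B)"
  have w0: "gsigma_weight z \<le> C * norm (z - c0)" for z
  proof (cases "z \<in> cball c0 1")
    case True
    have "gsigma_weight z \<le> norm (gsigma z) * 1"
      unfolding gsigma_weight_def by (intro mult_left_mono) auto
    also have "\<dots> \<le> B * norm (z - c0)" using lip[OF True] by simp
    also have "\<dots> \<le> C * norm (z - c0)" by (intro mult_right_mono) (auto simp: C_def)
    finally show ?thesis .
  next
    case False
    have "gsigma_weight z \<le> C * 1" using C1'[of z] by (simp add: C_def)
    also have "\<dots> \<le> C * norm (z - c0)"
      using False by (intro mult_left_mono) (auto simp: C_def dist_norm norm_minus_commute)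
    finally show ?thesis .
  qed
  have w: "norm (gsigma z) = gsigma_weight z * exp (pi / 2 * (norm z)\<^sup>2)" for z
    by (simp add: gsigma_weight_def flip: exp_add)
  show ?thesis
  proof (rule that[of C])
    show "C > 0" by (simp add: C_def)
    show "norm (gsigma z) \<le> C * exp (pi / 2 * (norm z)\<^sup>2)" for z
      unfolding w using C1'[of z] by (intro mult_right_mono) (auto simp: C_def)
    fix z and a b :: int
    have "gsigma_weight z = gsigma_weight (z + Complex (of_int (- a)) (of_int (- b - 1)))"
      by (rule gsigma_weight_periodic[symmetric])
    also have "\<dots> \<le> C * norm (z + Complex (of_int (- a)) (of_int (- b - 1)) - c0)" by (rule w0)
    also have "z + Complex (of_int (- a)) (of_int (- b - 1)) - c0 = z - Complex (of_int a + 1/2) (of_int b + 1/2)"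
      by (simp add: c0_def complex_eq_iff)
    finally show "norm (gsigma z) \<le>
        C * norm (z - Complex (of_int a + 1/2) (of_int b + 1/2)) * exp (pi / 2 * (norm z)\<^sup>2)"
      unfolding w by (intro mult_right_mono) auto
  qed
qed

lemma gsigma_0_nonzero: "gsigma 0 \<noteq> 0"
  by (simp add: gsigma_def theta_1_nonzero)

subsection \<open>Correction polynomials\<close>

lemma sum_int_powr_bounded:
  obtains U where "\<And>A :: int set. finite A \<Longrightarrow> (\<Sum>a\<in>A. (1 + \<bar>real_of_int a\<bar>) powr (- 3/2)) \<le> U"
proof -
  define u where "u n = (1 + real n) powr (- 3/2)" for n :: nat
  have "summable (\<lambda>n. real n powr (- 3/2))" by (simp add: summable_real_powr_iff)
  then have "summable (\<lambda>n. real (n + 1) powr (- 3/2))" by (rule summable_ignore_initial_segment)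
  then have su: "summable u" by (simp add: u_def[abs_def] add.commute)
  have part: "(\<Sum>a\<in>A. (1 + \<bar>real_of_int a\<bar>) powr (- 3/2)) \<le> suminf u"
    if "finite A" "inj_on (\<lambda>a. nat \<bar>a\<bar>) A" for A :: "int set"
  proof -
    have "(\<Sum>a\<in>A. (1 + \<bar>real_of_int a\<bar>) powr (- 3/2)) = sum u ((\<lambda>a. nat \<bar>a\<bar>) ` A)"
      by (subst sum.reindex[OF that(2)]) (simp add: u_def)
    also have "\<dots> \<le> suminf u"
      using that su by (intro sum_le_suminf) (auto simp: u_def)
    finally show ?thesis .
  qed
  show ?thesis
  proof (rule that[of "suminf u + suminf u"])
    fix A :: "int set" assume A: "finite A"
    let ?f = "\<lambda>a::int. (1 + \<bar>real_of_int a\<bar>) powr (- 3/2)"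
    have "A = (A \<inter> {0..}) \<union> (A \<inter> {..<0})" by auto
    then have "sum ?f A = sum ?f (A \<inter> {0..}) + sum ?f (A \<inter> {..<0})"
      using A by (metis (no_types, lifting) sum.union_disjoint finite_Int Int_assoc disjoint_iff
          IntE atLeast_iff lessThan_iff not_le)
    also have "\<dots> \<le> suminf u + suminf u"
      using A by (intro add_mono part) (auto simp: inj_on_def)
    finally show "sum ?f A \<le> suminf u + suminf u" .
  qed
qed

text \<open>A grid of mesh \<open>\<delta> / 2\<close> has at most one point per square, and up to a
  constant \<open>(1 + norm w) ^ 3\<close> dominates the power 3/2 of the product of the two
  (shifted) integer coordinates. The double sum thus factors into two convergent series, uniformly
  in \<open>S\<close> and \<open>z\<close>.\<close>

lemma separated_sum_bounded:
  fixes \<delta> :: real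
  assumes \<delta>: "0 < \<delta>"
  obtains M where "M \<ge> 0"
    "\<And>S z. finite S \<Longrightarrow> (\<And>p q. p \<in> S \<Longrightarrow> q \<in> S \<Longrightarrow> p \<noteq> q \<Longrightarrow> \<delta> \<le> norm (p - q)) \<Longrightarrow>
       (\<Sum>p\<in>S. 1 / (1 + norm (z - p :: complex)) ^ 3) \<le> M"
proof -
  define s where "s = \<delta> / 2"
  have s: "s > 0" using \<delta> by (simp add: s_def)
  define c where "c = max 2 (1 / s)"
  obtain U where U: "\<And>A :: int set. finite A \<Longrightarrow> (\<Sum>a\<in>A. (1 + \<bar>real_of_int a\<bar>) powr (- 3/2)) \<le> U"
    using sum_int_powr_bounded by blast
  have U0: "U \<ge> 0" using U[of "{}"] by simp
  have c: "c \<ge> 2" "1 / s \<le> c" by (auto simp: c_def)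
  define u where "u a = (1 + \<bar>real_of_int a\<bar>) powr (- 3/2)" for a
  have coord: "1 + \<bar>real_of_int \<lfloor>x / s\<rfloor>\<bar> \<le> c * (1 + r)" if "\<bar>x\<bar> \<le> r" for x r
  proof -
    have "\<bar>real_of_int \<lfloor>x / s\<rfloor>\<bar> \<le> \<bar>x / s\<bar> + 1" by linarith
    also have "\<bar>x / s\<bar> = 1 / s * \<bar>x\<bar>" using s by simp
    also have "1 / s * \<bar>x\<bar> \<le> c * r" using c that by (intro mult_mono) auto
    finally show ?thesis using c by (simp add: algebra_simps)
  qed
  have bound: "1 / (1 + norm w) ^ 3 \<le> c ^ 3 * (u \<lfloor>Re w / s\<rfloor> * u \<lfloor>Im w / s\<rfloor>)" for w
  proof -
    define X where "X = 1 + \<bar>real_of_int \<lfloor>Re w / s\<rfloor>\<bar>"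
    define Y where "Y = 1 + \<bar>real_of_int \<lfloor>Im w / s\<rfloor>\<bar>"
    have XY: "X > 0" "Y > 0" by (auto simp: X_def Y_def)
    have "X * Y \<le> (c * (1 + norm w)) * (c * (1 + norm w))"
      unfolding X_def Y_def using c
      by (intro mult_mono coord abs_Re_le_cmod abs_Im_le_cmod) auto
    then have "(X * Y) powr (3/2) \<le> ((c * (1 + norm w)) powr 2) powr (3/2)"
      using XY c by (intro powr_mono2) (auto simp: power2_eq_square)
    also have "\<dots> = (c * (1 + norm w)) powr (real 3)"
      unfolding powr_powr by simp
    also have "\<dots> = c ^ 3 * (1 + norm w) ^ 3"
      using c by (subst powr_realpow) (auto simp: power_mult_distrib add_pos_nonneg)
    finally have "(X * Y) powr (3/2) \<le> c ^ 3 * (1 + norm w) ^ 3" .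
    moreover have u: "u \<lfloor>Re w / s\<rfloor> * u \<lfloor>Im w / s\<rfloor> = 1 / ((X * Y) powr (3/2))"
      using XY by (simp add: u_def powr_mult powr_minus inverse_eq_divide flip: X_def Y_def)
    moreover have "(X * Y) powr (3/2) > 0" "(1 + norm w) ^ 3 > 0"
      using XY by (auto simp: add_pos_nonneg)
    ultimately show ?thesis unfolding u by (simp add: divide_le_eq le_divide_eq)
  qed
  show ?thesis
  proof (rule that[of "c ^ 3 * (U * U)"])
    show "0 \<le> c ^ 3 * (U * U)" using c U0 by simp
    fix S :: "complex set" and z :: complex
    assume S: "finite S" "\<And>p q. p \<in> S \<Longrightarrow> q \<in> S \<Longrightarrow> p \<noteq> q \<Longrightarrow> \<delta> \<le> norm (p - q)"
    define \<phi> where "\<phi> p = (\<lfloor>Re (z - p) / s\<rfloor>, \<lfloor>Im (z - p) / s\<rfloor>)" for p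
    have inj: "inj_on \<phi> S"
    proof (rule inj_onI, rule ccontr)
      fix p q assume pq: "p \<in> S" "q \<in> S" "\<phi> p = \<phi> q" "p \<noteq> q"
      have "\<bar>Re (z - p) / s - Re (z - q) / s\<bar> < 1" "\<bar>Im (z - p) / s - Im (z - q) / s\<bar> < 1"
        using pq(3) unfolding \<phi>_def prod.inject by linarith+
      then have "\<bar>Re (p - q)\<bar> < s" "\<bar>Im (p - q)\<bar> < s"
        using s by (simp_all add: abs_minus_commute flip: diff_divide_distrib)
      then have "norm (p - q) < \<delta>"
        using cmod_le[of "p - q"] by (simp add: s_def)
      with S(2)[OF pq(1,2,4)] show False by simp
    qed
    have "(\<Sum>p\<in>S. 1 / (1 + norm (z - p)) ^ 3) \<le> (\<Sum>p\<in>S. c ^ 3 * (u (fst (\<phi> p)) * u (snd (\<phi> p))))"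
      unfolding \<phi>_def fst_conv snd_conv by (intro sum_mono bound)
    also have "\<dots> = c ^ 3 * (\<Sum>x\<in>\<phi> ` S. u (fst x) * u (snd x))"
      by (simp add: sum.reindex[OF inj] sum_distrib_left)
    also have "(\<Sum>x\<in>\<phi> ` S. u (fst x) * u (snd x)) \<le>
        (\<Sum>x\<in>(fst ` \<phi> ` S) \<times> (snd ` \<phi> ` S). u (fst x) * u (snd x))"
      using S(1) subset_fst_snd[of "\<phi> ` S"] by (intro sum_mono2) (auto simp: u_def)
    also have "\<dots> = (\<Sum>a\<in>fst ` \<phi> ` S. u a) * (\<Sum>b\<in>snd ` \<phi> ` S. u b)"
      by (simp add: sum_product sum.cartesian_product split_beta)
    also have "\<dots> \<le> U * U"
      using S(1) U0 unfolding u_def by (intro mult_mono U sum_nonneg) auto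
    finally show "(\<Sum>p\<in>S. 1 / (1 + norm (z - p)) ^ 3) \<le> c ^ 3 * (U * U)"
      using c by (simp add: mult_left_mono)
  qed
qed

text \<open>The point is that \<open>B\<close> depends on \<open>m\<close> alone. Factors are split
  off one at a time, and multiplying by \<open>1 - w * u\<close> at most quadruples the bound. The
  radius 2 is the reciprocal of 1/2, the least distance from a centre at which the expansion is
  applied.\<close>

lemma prod_expansion_cubic:
  "\<exists>B\<ge>1. \<forall>W :: complex set. finite W \<longrightarrow> W \<subseteq> cball 0 1 \<longrightarrow> card W \<le> m \<longrightarrow>
     (\<exists>a b r. norm a \<le> B \<and> norm b \<le> B \<and>
        (\<forall>u. (\<Prod>w\<in>W. 1 - w * u) = 1 + a * u + b * u ^ 2 + u ^ 3 * r u \<and>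
             (norm u \<le> 2 \<longrightarrow> norm (r u) \<le> B)))"
proof (induction m)
  case 0
  have "\<forall>W :: complex set. finite W \<longrightarrow> W \<subseteq> cball 0 1 \<longrightarrow> card W \<le> 0 \<longrightarrow>
     (\<exists>a b r. norm a \<le> (1::real) \<and> norm b \<le> (1::real) \<and>
        (\<forall>u. (\<Prod>w\<in>W. 1 - w * u) = 1 + a * u + b * u ^ 2 + u ^ 3 * r u \<and>
             (norm u \<le> 2 \<longrightarrow> norm (r u) \<le> (1::real))))"
    by (auto intro!: exI[of _ "0::complex"] exI[of _ "\<lambda>_::complex. 0::complex"])
  then show ?case by (intro exI[of _ 1]) auto
next
  case (Suc m)
  then obtain B where B: "B \<ge> 1"
    and IH: "\<And>W :: complex set. finite W \<Longrightarrow> W \<subseteq> cball 0 1 \<Longrightarrow> card W \<le> m \<Longrightarrow>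
     (\<exists>a b r. norm a \<le> B \<and> norm b \<le> B \<and>
        (\<forall>u. (\<Prod>w\<in>W. 1 - w * u) = 1 + a * u + b * u ^ 2 + u ^ 3 * r u \<and>
             (norm u \<le> 2 \<longrightarrow> norm (r u) \<le> B)))"
    by blast
  have "\<exists>a b r. norm a \<le> 4 * B \<and> norm b \<le> 4 * B \<and>
        (\<forall>u. (\<Prod>w\<in>W. 1 - w * u) = 1 + a * u + b * u ^ 2 + u ^ 3 * r u \<and>
             (norm u \<le> 2 \<longrightarrow> norm (r u) \<le> 4 * B))"
    if W: "finite W" "W \<subseteq> cball 0 1" "card W \<le> Suc m" for W :: "complex set"
  proof (cases "W = {}")
    case True
    then show ?thesis
      using B by (auto intro!: exI[of _ "0::complex"] exI[of _ "\<lambda>_::complex. 0::complex"])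
  next
    case False
    then obtain w where w: "w \<in> W" by auto
    have w1: "norm w \<le> 1" using w W by auto
    obtain a b r where abr: "norm a \<le> B" "norm b \<le> B"
      and exp: "\<And>u. (\<Prod>w\<in>W - {w}. 1 - w * u) = 1 + a * u + b * u ^ 2 + u ^ 3 * r u"
      and r: "\<And>u. norm u \<le> 2 \<Longrightarrow> norm (r u) \<le> B"
    proof -
      have "finite (W - {w})" "W - {w} \<subseteq> cball 0 1" "card (W - {w}) \<le> m"
        using W w by auto
      from IH[OF this] show ?thesis using that by blast
    qed
    define r' where "r' u = r u - w * b - w * u * r u" for u
    have "norm (a - w) \<le> 4 * B"
      using norm_triangle_ineq4[of a w] abr w1 B by linarith
    moreover have "norm (b - w * a) \<le> 4 * B"
    proof -
      have "norm (w * a) \<le> 1 * B" unfolding norm_mult using abr w1 by (intro mult_mono) auto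
      then show ?thesis using norm_triangle_ineq4[of b "w * a"] abr B by linarith
    qed
    moreover have "norm (r' u) \<le> 4 * B" if "norm u \<le> 2" for u
    proof -
      have "norm (w * b) \<le> 1 * B" unfolding norm_mult using abr w1 by (intro mult_mono) auto
      moreover have "norm (w * u * r u) \<le> 1 * 2 * B"
        unfolding norm_mult using w1 that r[OF that] by (intro mult_mono) auto
      ultimately show ?thesis
        using r[OF that] norm_triangle_ineq4[of "r u - w * b" "w * u * r u"]
          norm_triangle_ineq4[of "r u" "w * b"] by (simp add: r'_def)
    qed
    moreover have "(\<Prod>w\<in>W. 1 - w * u) = 1 + (a - w) * u + (b - w * a) * u ^ 2 + u ^ 3 * r' u" for u
      using W w by (subst prod.remove[of _ w])
        (auto simp: exp r'_def algebra_simps power2_eq_square power3_eq_cube)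
    ultimately show ?thesis by blast
  qed
  then show ?case using B by (intro exI[of _ "4 * B"]) auto
qed

text \<open>The free coefficient \<open>t\<close> is used to normalise the factor at \<open>u0\<close>; the other two kill the terms of
  order 1 and 2 in the expansion at 0.\<close>
lemma correction_factor:
  fixes \<eta> :: real
  assumes \<eta>: "0 < \<eta>" "\<eta> \<le> 1"
  obtains B where "B \<ge> 1"
    "\<And>W u0. finite W \<Longrightarrow> W \<subseteq> cball 0 1 \<Longrightarrow> card W \<le> m \<Longrightarrow> u0 \<noteq> 0 \<Longrightarrow> norm u0 \<le> 2 \<Longrightarrow>
       (\<And>w. w \<in> W \<Longrightarrow> \<eta> \<le> norm (1 - w * u0)) \<Longrightarrow>
       \<exists>q1 q2 t :: complex. norm q1 \<le> B \<and> norm q2 \<le> B \<and> norm t \<le> B \<and>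
         (\<Prod>w\<in>W. 1 - w * u0) * (1 + q1 * u0 + q2 * u0 ^ 2 + t * u0 ^ 3) = 1 \<and>
         (\<forall>u. norm u \<le> 2 \<longrightarrow>
            norm ((\<Prod>w\<in>W. 1 - w * u) * (1 + q1 * u + q2 * u ^ 2 + t * u ^ 3) - 1) \<le> B * norm u ^ 3)"
proof -
  obtain B where B: "B \<ge> 1"
    and exps: "\<And>W :: complex set. finite W \<Longrightarrow> W \<subseteq> cball 0 1 \<Longrightarrow> card W \<le> m \<Longrightarrow>
     (\<exists>a b r. norm a \<le> B \<and> norm b \<le> B \<and>
        (\<forall>u. (\<Prod>w\<in>W. 1 - w * u) = 1 + a * u + b * u ^ 2 + u ^ 3 * r u \<and>
             (norm u \<le> 2 \<longrightarrow> norm (r u) \<le> B)))"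
    using prod_expansion_cubic by blast
  define B2 where "B2 = B * B + B"
  define B3 where "B3 = B * (1 + B * 2 + B2 * 4) + B * B2 + B * B + B * B2 * 2"
  define B4 where "B4 = B3 / \<eta> ^ m"
  define B5 where "B5 = B3 + (1 + B * 2 + B * 4 + 8 * B) * B4"
  have B2: "B2 \<ge> B" using B by (simp add: B2_def)
  have B30: "0 \<le> B3" using B B2 by (auto simp: B3_def intro!: add_nonneg_nonneg mult_nonneg_nonneg)
  have B40: "0 \<le> B4" using B30 \<eta> by (simp add: B4_def)
  define B' where "B' = B + B2 + B4 + B5"
  have B50: "0 \<le> B5" using B30 B40 B by (auto simp: B5_def intro!: add_nonneg_nonneg mult_nonneg_nonneg)
  show ?thesis
  proof (rule that[of B'])
    show "1 \<le> B'" using B B2 B40 B50 by (simp add: B'_def)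
    fix W :: "complex set" and u0 :: complex
    assume W: "finite W" "W \<subseteq> cball 0 1" "card W \<le> m" and u0: "u0 \<noteq> 0" "norm u0 \<le> 2"
      and low: "\<And>w. w \<in> W \<Longrightarrow> \<eta> \<le> norm (1 - w * u0)"
    obtain a b r where abr: "norm a \<le> B" "norm b \<le> B"
      and exp: "\<And>u. (\<Prod>w\<in>W. 1 - w * u) = 1 + a * u + b * u ^ 2 + u ^ 3 * r u"
      and r: "\<And>u. norm u \<le> 2 \<Longrightarrow> norm (r u) \<le> B"
      using exps[OF W] by blast
    define P where "P u = (\<Prod>w\<in>W. 1 - w * u)" for u
    \<comment> \<open>\<open>1 - a * u + q * u\<^sup>2\<close> is the second Taylor polynomial of
      \<open>1 / P\<close>, so its product with \<open>P\<close> is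
      \<open>1 + u ^ 3 * R u\<close>.\<close>
    define q where "q = a * a - b"
    define R where "R u = r u * (1 - a * u + q * u\<^sup>2) + a * q - b * a + b * q * u" for u
    \<comment> \<open>The solution of \<open>R u0 + P u0 * t = 0\<close>; the lower bound
      \<open>\<eta> ^ m\<close> for \<open>norm (P u0)\<close> keeps it bounded.\<close>
    define t where "t = - R u0 / P u0"
    have PR: "P u * (1 + (- a) * u + q * u ^ 2 + t * u ^ 3) = 1 + u ^ 3 * (R u + P u * t)" for u
    proof -
      have "P u * (1 + (- a) * u + q * u ^ 2) = 1 + u ^ 3 * R u"
        unfolding P_def exp R_def q_def by (simp add: algebra_simps power2_eq_square power3_eq_cube)
      then show ?thesis by (simp add: algebra_simps)
    qed
    have nq: "norm q \<le> B2"
    proof -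
      have "norm (a * a) \<le> B * B" unfolding norm_mult using abr B by (intro mult_mono) auto
      then show ?thesis using norm_triangle_ineq4[of "a * a" b] abr by (simp add: q_def B2_def)
    qed
    have nR: "norm (R u) \<le> B3" if u: "norm u \<le> 2" for u
    proof -
      have u2: "norm (u\<^sup>2) \<le> 4" using power_mono[OF u, of 2] by (simp add: norm_power)
      have 1: "norm (a * u) \<le> B * 2" "norm (q * u\<^sup>2) \<le> B2 * 4" "norm (a * q) \<le> B * B2"
        "norm (b * a) \<le> B * B" "norm (b * q * u) \<le> B * B2 * 2"
        unfolding norm_mult[of _ u] norm_mult[of _ "u\<^sup>2"] norm_mult[of a q] norm_mult[of b _]
        using abr nq u u2 B B2 by (intro mult_mono; simp)+
      have "norm (1 - a * u + q * u\<^sup>2) \<le> 1 + B * 2 + B2 * 4"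
        using norm_triangle_ineq[of "1 - a * u" "q * u\<^sup>2"] norm_triangle_ineq4[of 1 "a * u"] 1 by simp
      then have "norm (r u * (1 - a * u + q * u\<^sup>2)) \<le> B * (1 + B * 2 + B2 * 4)"
        unfolding norm_mult using r[OF u] B by (intro mult_mono) auto
      then show ?thesis
        unfolding R_def B3_def
        using 1 norm_triangle_ineq[of "r u * (1 - a * u + q * u\<^sup>2) + a * q - b * a" "b * q * u"]
          norm_triangle_ineq4[of "r u * (1 - a * u + q * u\<^sup>2) + a * q" "b * a"]
          norm_triangle_ineq[of "r u * (1 - a * u + q * u\<^sup>2)" "a * q"] by linarith
    qed
    have nP: "norm (P u) \<le> 1 + B * 2 + B * 4 + 8 * B" if u: "norm u \<le> 2" for u
    proof -
      have u2: "norm (u\<^sup>2) \<le> 4" "norm (u ^ 3) \<le> 8"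
        using power_mono[OF u, of 2] power_mono[OF u, of 3] by (simp_all add: norm_power)
      have "norm (a * u) \<le> B * 2" "norm (b * u\<^sup>2) \<le> B * 4" "norm (u ^ 3 * r u) \<le> 8 * B"
        unfolding norm_mult using abr u u2 r[OF u] B by (intro mult_mono; simp)+
      then show ?thesis
        unfolding P_def exp
        using norm_triangle_ineq[of "1 + a * u + b * u\<^sup>2" "u ^ 3 * r u"]
          norm_triangle_ineq[of "1 + a * u" "b * u\<^sup>2"] norm_triangle_ineq[of 1 "a * u"] by simp
    qed
    have Plow: "\<eta> ^ m \<le> norm (P u0)"
    proof -
      have "\<eta> ^ m \<le> \<eta> ^ card W" using \<eta> W by (intro power_decreasing) auto
      also have "\<dots> = (\<Prod>w\<in>W. \<eta>)" by simp
      also have "\<dots> \<le> (\<Prod>w\<in>W. norm (1 - w * u0))" using low \<eta> by (intro prod_mono) auto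
      finally show ?thesis by (simp add: P_def prod_norm)
    qed
    have \<eta>m: "0 < \<eta> ^ m" using \<eta> by simp
    have P0: "P u0 \<noteq> 0" using Plow \<eta>m by auto
    have nt: "norm t \<le> B4"
      unfolding t_def B4_def norm_divide norm_minus_cancel
      using nR[OF u0(2)] Plow \<eta>m B30 by (intro frac_le) auto
    show "\<exists>q1 q2 t :: complex. norm q1 \<le> B' \<and> norm q2 \<le> B' \<and> norm t \<le> B' \<and>
         (\<Prod>w\<in>W. 1 - w * u0) * (1 + q1 * u0 + q2 * u0 ^ 2 + t * u0 ^ 3) = 1 \<and>
         (\<forall>u. norm u \<le> 2 \<longrightarrow>
            norm ((\<Prod>w\<in>W. 1 - w * u) * (1 + q1 * u + q2 * u ^ 2 + t * u ^ 3) - 1) \<le> B' * norm u ^ 3)"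
      unfolding P_def[symmetric]
    proof (rule exI[of _ "- a"], rule exI[of _ q], rule exI[of _ t], intro conjI allI impI)
      show "norm (- a) \<le> B'" "norm q \<le> B'" "norm t \<le> B'"
        using abr nq nt B B2 B40 B50 by (auto simp: B'_def)
      show "P u0 * (1 + - a * u0 + q * u0\<^sup>2 + t * u0 ^ 3) = 1"
        unfolding PR using P0 by (simp add: t_def)
      fix u :: complex assume u: "norm u \<le> 2"
      have "norm (P u * t) \<le> (1 + B * 2 + B * 4 + 8 * B) * B4"
        unfolding norm_mult using nP[OF u] nt B by (intro mult_mono) auto
      then have "norm (R u + P u * t) \<le> B5"
        using nR[OF u] norm_triangle_ineq[of "R u" "P u * t"] by (simp add: B5_def)
      also have "B5 \<le> B'" using B B2 B40 by (simp add: B'_def)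
      finally have "norm u ^ 3 * norm (R u + P u * t) \<le> norm u ^ 3 * B'"
        by (intro mult_left_mono) auto
      then show "norm (P u * (1 + - a * u + q * u\<^sup>2 + t * u ^ 3) - 1) \<le> B' * norm u ^ 3"
        unfolding PR by (simp add: norm_mult norm_power mult.commute)
    qed
  qed
qed

text \<open>In the variable \<open>u = 1 / (z - c)\<close> a monic polynomial of degree
  \<open>K\<close> is \<open>(z - c) ^ K\<close> times a polynomial \<open>F u\<close> with
  \<open>F 0 = 1\<close>, and the origin becomes \<open>u0 = - 1 / c\<close>: the setting of
  \<open>correction_factor\<close>. At 0 the new polynomial takes the value of the power that it
  replaces.\<close>

lemma cell_polynomial:
  fixes \<delta> :: real
  assumes \<delta>: "0 < \<delta>" and K: "3 \<le> K"
  obtains B where "B \<ge> 1"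
    "\<And>c S. finite S \<Longrightarrow> S \<subseteq> cball c 1 \<Longrightarrow> card S + 3 \<le> K \<Longrightarrow> 1/2 \<le> norm c \<Longrightarrow>
       (\<And>w. w \<in> S \<Longrightarrow> \<delta> \<le> norm w) \<Longrightarrow>
       \<exists>P. P holomorphic_on UNIV \<and> (\<forall>w\<in>S. P w = 0) \<and> P 0 = (- c) ^ K \<and>
         (\<forall>z. norm (z - c) \<le> 1 \<longrightarrow> norm (P z) \<le> B) \<and>
         (\<forall>z. 1/2 \<le> norm (z - c) \<longrightarrow> norm (P z) \<le> norm (z - c) ^ K * (1 + B / norm (z - c) ^ 3))"
proof -
  \<comment> \<open>At \<open>u0 = - 1 / c\<close> the factor of a root \<open>s\<close> is
    \<open>s / c\<close>. From \<open>norm c <= norm s + 1\<close> and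
    \<open>norm s >= \<delta>\<close> its modulus is at least \<eta>, however far away the cell
    is.\<close>
  define \<eta> where "\<eta> = \<delta> / (1 + \<delta>)"
  have \<eta>: "0 < \<eta>" "\<eta> \<le> 1" using \<delta> by (auto simp: \<eta>_def)
  obtain B where B: "B \<ge> 1" and corr:
    "\<And>W u0. finite W \<Longrightarrow> W \<subseteq> cball 0 1 \<Longrightarrow> card W \<le> K \<Longrightarrow> u0 \<noteq> 0 \<Longrightarrow> norm u0 \<le> 2 \<Longrightarrow>
       (\<And>w. w \<in> W \<Longrightarrow> \<eta> \<le> norm (1 - w * u0)) \<Longrightarrow>
       \<exists>q1 q2 t :: complex. norm q1 \<le> B \<and> norm q2 \<le> B \<and> norm t \<le> B \<and>
         (\<Prod>w\<in>W. 1 - w * u0) * (1 + q1 * u0 + q2 * u0 ^ 2 + t * u0 ^ 3) = 1 \<and>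
         (\<forall>u. norm u \<le> 2 \<longrightarrow>
            norm ((\<Prod>w\<in>W. 1 - w * u) * (1 + q1 * u + q2 * u ^ 2 + t * u ^ 3) - 1) \<le> B * norm u ^ 3)"
    using correction_factor[OF \<eta>, of K] by blast
  define B' where "B' = 2 ^ K * (1 + 3 * B)"
  have BB': "B \<le> B'"
  proof -
    have "1 * B \<le> 2 ^ K * (1 + 3 * B)" using B by (intro mult_mono) auto
    then show ?thesis by (simp add: B'_def)
  qed
  show ?thesis
  proof (rule that[of B'])
    show "1 \<le> B'" using B BB' by simp
    fix c :: complex and S :: "complex set"
    assume S: "finite S" "S \<subseteq> cball c 1" "card S + 3 \<le> K" and c: "1/2 \<le> norm c"
      and low: "\<And>w. w \<in> S \<Longrightarrow> \<delta> \<le> norm w"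
    define W where "W = (\<lambda>w. w - c) ` S"
    have c0: "c \<noteq> 0" using c by auto
    have injS: "inj_on (\<lambda>w. w - c) S" by (auto simp: inj_on_def)
    have cW: "card W = card S" unfolding W_def by (rule card_image[OF injS])
    have W: "finite W" "W \<subseteq> cball 0 1" "card W \<le> K"
      using S cW by (auto simp: W_def dist_norm norm_minus_commute)
    have "\<eta> \<le> norm (1 - w * (- 1 / c))" if "w \<in> W" for w
    proof -
      obtain s where s: "s \<in> S" "w = s - c" using \<open>w \<in> W\<close> by (auto simp: W_def)
      have eq: "1 - w * (- 1 / c) = s / c" using s c0 by (simp add: field_simps)
      have "norm c \<le> norm s + 1"
        using s S(2) norm_triangle_ineq2[of c s] by (auto simp: dist_norm)
      also have "\<dots> \<le> norm s * ((1 + \<delta>) / \<delta>)"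
        using low[OF s(1)] \<delta> by (simp add: field_simps)
      finally have "\<eta> * norm c \<le> norm s"
        using \<delta> by (simp add: \<eta>_def field_simps)
      then show ?thesis unfolding eq using c0 by (simp add: norm_divide field_simps)
    qed
    with corr[OF W, of "- 1 / c"] c c0 obtain q1 q2 t where
      q: "norm q1 \<le> B" "norm q2 \<le> B" "norm t \<le> B" and
      norm0: "(\<Prod>w\<in>W. 1 - w * (- 1 / c)) * (1 + q1 * (- 1 / c) + q2 * (- 1 / c) ^ 2 + t * (- 1 / c) ^ 3) = 1"
      and far: "\<And>u. norm u \<le> 2 \<Longrightarrow>
            norm ((\<Prod>w\<in>W. 1 - w * u) * (1 + q1 * u + q2 * u ^ 2 + t * u ^ 3) - 1) \<le> B * norm u ^ 3"
      by (auto simp: norm_divide field_simps)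
    \<comment> \<open>The last factor carries the three spare coefficients, in reversed order
      compared with \<open>F\<close>; the power of \<open>x\<close> pads the degree to
      \<open>K\<close> if the cell has fewer than \<open>K - 3\<close> points.\<close>
    define Q where "Q x = x ^ (K - 3 - card W) * (\<Prod>w\<in>W. x - w) * (x ^ 3 + q1 * x ^ 2 + q2 * x + t)" for x
    define F where "F u = (\<Prod>w\<in>W. 1 - w * u) * (1 + q1 * u + q2 * u ^ 2 + t * u ^ 3)" for u
    have QF: "Q x = x ^ K * F (1 / x)" if x: "x \<noteq> 0" for x
    proof -
      have "(\<Prod>w\<in>W. x - w) = (\<Prod>w\<in>W. x * (1 - w * (1 / x)))"
        using x by (intro prod.cong) (auto simp: field_simps)
      also have "\<dots> = x ^ card W * (\<Prod>w\<in>W. 1 - w * (1 / x))"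
        by (simp add: prod.distrib)
      finally have 1: "(\<Prod>w\<in>W. x - w) = x ^ card W * (\<Prod>w\<in>W. 1 - w * (1 / x))" .
      have 2: "x ^ 3 + q1 * x ^ 2 + q2 * x + t = x ^ 3 * (1 + q1 * (1 / x) + q2 * (1 / x) ^ 2 + t * (1 / x) ^ 3)"
        using x by (simp add: field_simps power2_eq_square power3_eq_cube)
      have "K = (K - 3 - card W) + card W + 3" using S(3) cW by simp
      then have 3: "x ^ K = x ^ (K - 3 - card W) * x ^ card W * x ^ 3"
        by (metis power_add)
      show ?thesis unfolding Q_def F_def 1 2 3 by (simp add: mult_ac)
    qed
    show "\<exists>P. P holomorphic_on UNIV \<and> (\<forall>w\<in>S. P w = 0) \<and> P 0 = (- c) ^ K \<and>
         (\<forall>z. norm (z - c) \<le> 1 \<longrightarrow> norm (P z) \<le> B') \<and>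
         (\<forall>z. 1/2 \<le> norm (z - c) \<longrightarrow> norm (P z) \<le> norm (z - c) ^ K * (1 + B' / norm (z - c) ^ 3))"
    proof (intro exI[of _ "\<lambda>z. Q (z - c)"] conjI allI ballI impI)
      show "(\<lambda>z. Q (z - c)) holomorphic_on UNIV"
        unfolding Q_def by (intro holomorphic_intros)
      show "Q (w - c) = 0" if "w \<in> S" for w
        using that W by (auto simp: Q_def W_def prod_zero_iff)
      have "F (1 / (- c)) = 1" using norm0 by (simp add: F_def)
      then show "Q (0 - c) = (- c) ^ K" using c0 by (simp add: QF)
    next
      fix z assume z: "norm (z - c) \<le> 1"
      define x where "x = z - c"
      have x: "norm x \<le> 1" using z by (simp add: x_def)
      have "norm (\<Prod>w\<in>W. x - w) \<le> (\<Prod>w\<in>W. 2)"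
        unfolding prod_norm[symmetric]
      proof (intro prod_mono conjI)
        fix w assume "w \<in> W"
        then show "norm (x - w) \<le> 2" using x W norm_triangle_ineq4[of x w] by force
      qed auto
      also have "\<dots> = 2 ^ card W" by simp
      also have "\<dots> \<le> 2 ^ K" using W by (intro power_increasing) auto
      finally have 1: "norm (\<Prod>w\<in>W. x - w) \<le> 2 ^ K" .
      have xn: "norm (x ^ n) \<le> 1" for n using x by (simp add: norm_power power_le_one)
      have "norm (q1 * x ^ 2) \<le> B * 1" "norm (q2 * x) \<le> B * 1"
        unfolding norm_mult using q B x xn by (intro mult_mono; simp)+
      then have 2: "norm (x ^ 3 + q1 * x ^ 2 + q2 * x + t) \<le> 1 + 3 * B"
        using q xn[of 3] norm_triangle_ineq[of "x ^ 3 + q1 * x ^ 2 + q2 * x" t]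
          norm_triangle_ineq[of "x ^ 3 + q1 * x ^ 2" "q2 * x"] norm_triangle_ineq[of "x ^ 3" "q1 * x ^ 2"]
        by simp
      have "norm (Q x) \<le> 1 * 2 ^ K * (1 + 3 * B)"
        unfolding Q_def norm_mult using 1 2 xn B by (intro mult_mono) auto
      then show "norm (Q (z - c)) \<le> B'" by (simp add: B'_def x_def)
    next
      fix z assume z: "1/2 \<le> norm (z - c)"
      then have z0: "z - c \<noteq> 0" by auto
      have "norm (F (1 / (z - c))) \<le> 1 + norm (F (1 / (z - c)) - 1)"
        using norm_triangle_ineq[of 1 "F (1 / (z - c)) - 1"] by simp
      also have "norm (F (1 / (z - c)) - 1) \<le> B * norm (1 / (z - c)) ^ 3"
        unfolding F_def using z z0 by (intro far) (auto simp: norm_divide field_simps)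
      also have "\<dots> \<le> B' / norm (z - c) ^ 3"
        using BB' by (simp add: norm_divide power_divide divide_right_mono)
      finally show "norm (Q (z - c)) \<le> norm (z - c) ^ K * (1 + B' / norm (z - c) ^ 3)"
        unfolding QF[OF z0] norm_mult norm_power by (intro mult_left_mono) auto
    qed
  qed
qed

subsection \<open>Functions vanishing on a separated set\<close>

text \<open>Zeros are divided out one at a time as removable singularities. This makes the
  replacement of linear factors of \<open>gsigma\<close> meaningful at the zeros themselves.\<close>

lemma entire_factor_zeros:
  assumes "finite A" "f holomorphic_on UNIV" "\<And>a. a \<in> A \<Longrightarrow> f a = 0"
  obtains k where "k holomorphic_on UNIV" "\<And>z. f z = k z * (\<Prod>a\<in>A. z - a)"
  using assms
proof (induction A arbitrary: f thesis rule: finite_induct)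
  case empty
  then show ?case by simp
next
  case (insert a A)
  obtain k where k: "k holomorphic_on UNIV" "\<And>z. f z = k z * (\<Prod>a\<in>A. z - a)"
    using insert.IH[of f] insert.prems by blast
  have "(\<Prod>b\<in>A. a - b) \<noteq> 0" using insert.hyps by (auto simp: prod_zero_iff)
  then have ka: "k a = 0" using k(2)[of a] insert.prems by auto
  define k' where "k' z = (if z = a then deriv k a else (k z - k a) / (z - a))" for z
  have "k' holomorphic_on UNIV"
    unfolding k'_def[abs_def] using k(1) by (intro pole_lemma) auto
  moreover have "k z = k' z * (z - a)" for z by (simp add: k'_def ka)
  ultimately show ?case
    using insert.hyps k(2) by (intro insert.prems(1)[of k']) (auto simp: mult_ac)
qed

section \<open>The unit grid\<close>

definition cell :: "complex \<Rightarrow> int \<times> int" where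
  "cell z = (\<lfloor>Re z\<rfloor>, \<lfloor>Im z\<rfloor>)"

definition centre :: "int \<times> int \<Rightarrow> complex" where
  "centre i = Complex (of_int (fst i) + 1/2) (of_int (snd i) + 1/2)"

lemma abs_diff_of_int_half:
  fixes x :: real
  assumes "a \<noteq> \<lfloor>x\<rfloor>"
  shows "1/2 \<le> \<bar>x - (of_int a + 1/2)\<bar>"
proof (cases "a < \<lfloor>x\<rfloor>")
  case True
  then have "real_of_int a + 1 \<le> of_int \<lfloor>x\<rfloor>" by linarith
  then show ?thesis using of_int_floor_le[of x] by linarith
next
  case False
  then have "of_int \<lfloor>x\<rfloor> + 1 \<le> real_of_int a" using assms by linarith
  then show ?thesis using real_of_int_floor_add_one_gt[of x] by linarith
qed

lemma norm_diff_centre_cell: "norm (z - centre (cell z)) \<le> 1"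
proof -
  have "\<bar>Re (z - centre (cell z))\<bar> \<le> 1/2" "\<bar>Im (z - centre (cell z))\<bar> \<le> 1/2"
    unfolding centre_def cell_def fst_conv snd_conv minus_complex.sel complex.sel by linarith+
  then show ?thesis using cmod_le[of "z - centre (cell z)"] by simp
qed

lemma norm_diff_centre_other:
  assumes "i \<noteq> cell z"
  shows "1/2 \<le> norm (z - centre i)"
proof -
  consider "fst i \<noteq> \<lfloor>Re z\<rfloor>" | "snd i \<noteq> \<lfloor>Im z\<rfloor>"
    using assms by (auto simp: cell_def prod_eq_iff)
  then have "1/2 \<le> \<bar>Re (z - centre i)\<bar> \<or> 1/2 \<le> \<bar>Im (z - centre i)\<bar>"
    by cases (auto simp: centre_def dest: abs_diff_of_int_half)
  then show ?thesis
    using abs_Re_le_cmod[of "z - centre i"] abs_Im_le_cmod[of "z - centre i"] by linarith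
qed

lemma norm_centre_ge: "1/2 \<le> norm (centre i)"
proof -
  have "1/2 \<le> \<bar>Re (centre i)\<bar>"
    unfolding centre_def complex.sel by (cases "0 \<le> fst i") linarith+
  then show ?thesis using abs_Re_le_cmod[of "centre i"] by linarith
qed

lemma centre_separated:
  assumes "i \<noteq> j"
  shows "1 \<le> norm (centre i - centre j)"
proof -
  consider "fst i \<noteq> fst j" | "snd i \<noteq> snd j" using assms by (auto simp: prod_eq_iff)
  then have "1 \<le> \<bar>Re (centre i - centre j)\<bar> \<or> 1 \<le> \<bar>Im (centre i - centre j)\<bar>"
    by cases (simp_all add: centre_def, linarith+)
  then show ?thesis
    using abs_Re_le_cmod[of "centre i - centre j"] abs_Im_le_cmod[of "centre i - centre j"] by linarith
qed

lemma inj_centre: "inj centre"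
proof (rule injI, rule ccontr)
  fix i j assume "centre i = centre j" "i \<noteq> j"
  with centre_separated[of i j] show False by simp
qed

text \<open>\<open>D\<close> depends on \<delta> and \<open>K\<close> only; the passage to infinite
  sets and the uniformity over all base points rest on this. Factors of \<open>gsigma ^ K\<close>
  are exchanged only in the finitely many cells that meet \<open>S\<close>.\<close>

lemma interpolate_0_finite:
  fixes \<delta> :: real
  assumes \<delta>: "0 < \<delta>" and K: "3 \<le> K"
  obtains D where "D > 0"
    "\<And>S. finite S \<Longrightarrow> (\<And>w. w \<in> S \<Longrightarrow> \<delta> \<le> norm w) \<Longrightarrow>
       (\<And>i. card {w \<in> S. cell w = i} + 3 \<le> K) \<Longrightarrow>
       \<exists>G. G holomorphic_on UNIV \<and> G 0 = 1 \<and> (\<forall>w\<in>S. G w = 0) \<and>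
         (\<forall>z. norm (G z) \<le> D * exp (pi * K / 2 * (norm z)\<^sup>2))"
proof -
  obtain B where B: "B \<ge> 1" and cellpoly:
    "\<And>c S. finite S \<Longrightarrow> S \<subseteq> cball c 1 \<Longrightarrow> card S + 3 \<le> K \<Longrightarrow> 1/2 \<le> norm c \<Longrightarrow>
       (\<And>w. w \<in> S \<Longrightarrow> \<delta> \<le> norm w) \<Longrightarrow>
       \<exists>P. P holomorphic_on UNIV \<and> (\<forall>w\<in>S. P w = 0) \<and> P 0 = (- c) ^ K \<and>
         (\<forall>z. norm (z - c) \<le> 1 \<longrightarrow> norm (P z) \<le> B) \<and>
         (\<forall>z. 1/2 \<le> norm (z - c) \<longrightarrow> norm (P z) \<le> norm (z - c) ^ K * (1 + B / norm (z - c) ^ 3))"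
    using cell_polynomial[OF \<delta> K] by blast
  obtain C where C: "C > 0" "\<And>z. norm (gsigma z) \<le> C * exp (pi / 2 * (norm z)\<^sup>2)"
    "\<And>z a b. norm (gsigma z) \<le>
        C * norm (z - Complex (of_int a + 1/2) (of_int b + 1/2)) * exp (pi / 2 * (norm z)\<^sup>2)"
    using gsigma_bounds by blast
  have Cc: "norm (gsigma z) \<le> C * norm (z - centre i) * exp (pi / 2 * (norm z)\<^sup>2)" for z i
    unfolding centre_def by (rule C(3))
  obtain M where M: "M \<ge> 0"
    "\<And>S z. finite S \<Longrightarrow> (\<And>p q. p \<in> S \<Longrightarrow> q \<in> S \<Longrightarrow> p \<noteq> q \<Longrightarrow> 1 \<le> norm (p - q)) \<Longrightarrow>
       (\<Sum>p\<in>S. 1 / (1 + norm (z - p :: complex)) ^ 3) \<le> M"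
    using separated_sum_bounded[of 1] by auto
  \<comment> \<open>\<open>C ^ K\<close> accounts for \<open>gsigma ^ K\<close>, \<open>B\<close>
    for the polynomial of the cell containing \<open>z\<close>, the exponential for all other cells;
    the denominator normalises at 0.\<close>
  define D where "D = (C ^ K * B * exp (27 * B * M)) / norm (gsigma 0) ^ K"
  have g0: "norm (gsigma 0) > 0" using gsigma_0_nonzero by simp
  show ?thesis
  proof (rule that[of D])
    show "D > 0" using C(1) B g0 by (simp add: D_def)
    fix S assume S: "finite S" and low: "\<And>w. w \<in> S \<Longrightarrow> \<delta> \<le> norm w"
      and card: "\<And>i. card {w \<in> S. cell w = i} + 3 \<le> K"
    define I where "I = cell ` S"
    have I: "finite I" using S by (simp add: I_def)
    have "\<exists>P. P holomorphic_on UNIV \<and> (\<forall>w\<in>{w\<in>S. cell w = i}. P w = 0) \<and> P 0 = (- centre i) ^ K \<and>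
         (\<forall>z. norm (z - centre i) \<le> 1 \<longrightarrow> norm (P z) \<le> B) \<and>
         (\<forall>z. 1/2 \<le> norm (z - centre i) \<longrightarrow>
            norm (P z) \<le> norm (z - centre i) ^ K * (1 + B / norm (z - centre i) ^ 3))" for i
    proof (rule cellpoly)
      show "{w \<in> S. cell w = i} \<subseteq> cball (centre i) 1"
        using norm_diff_centre_cell by (auto simp: dist_norm norm_minus_commute)
    qed (use S low card norm_centre_ge in auto)
    then obtain P where P: "\<And>i. P i holomorphic_on UNIV"
      "\<And>i w. w \<in> S \<Longrightarrow> cell w = i \<Longrightarrow> P i w = 0" "\<And>i. P i 0 = (- centre i) ^ K"
      "\<And>i z. norm (z - centre i) \<le> 1 \<Longrightarrow> norm (P i z) \<le> B"
      "\<And>i z. 1/2 \<le> norm (z - centre i) \<Longrightarrow>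
            norm (P i z) \<le> norm (z - centre i) ^ K * (1 + B / norm (z - centre i) ^ 3)"
      by (metis (mono_tags, lifting) mem_Collect_eq)
    have "gsigma c = 0" if c: "c \<in> centre ` I" for c
    proof -
      obtain i where "c = centre i" using c by blast
      with Cc[of c i] show ?thesis by simp
    qed
    then obtain k where k: "k holomorphic_on UNIV"
      and gk': "\<And>z. gsigma z = k z * (\<Prod>c\<in>centre ` I. z - c)"
      using entire_factor_zeros[of "centre ` I" gsigma] I holomorphic_gsigma by blast
    have gk: "gsigma z = k z * (\<Prod>i\<in>I. z - centre i)" for z
      unfolding gk' by (subst prod.reindex) (auto intro: inj_on_subset[OF inj_centre])
    define G where "G z = k z ^ K * (\<Prod>i\<in>I. P i z) / gsigma 0 ^ K" for z
    have holG: "G holomorphic_on UNIV"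
      unfolding G_def by (intro holomorphic_intros k P) (use g0 in auto)
    have "G 0 = 1"
    proof -
      have "gsigma 0 ^ K = k 0 ^ K * (\<Prod>i\<in>I. P i 0)"
        unfolding gk[of 0] P(3) power_mult_distrib by (simp add: prod_power_distrib)
      then have "G 0 = gsigma 0 ^ K / gsigma 0 ^ K" by (simp add: G_def)
      then show ?thesis using g0 by simp
    qed
    moreover have "G w = 0" if "w \<in> S" for w
    proof -
      have "(\<Prod>i\<in>I. P i w) = 0"
        using that I P(2)[OF that refl] by (auto simp: I_def prod_zero_iff)
      then show ?thesis by (simp add: G_def)
    qed
    moreover have "norm (G z) \<le> D * exp (pi * K / 2 * (norm z)\<^sup>2)" for z
    proof -
      let ?E = "\<lambda>z. exp (pi / 2 * (norm z)\<^sup>2)"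
      have E: "?E z ^ K = exp (pi * K / 2 * (norm z)\<^sup>2)" for z :: complex
        unfolding exp_of_nat_mult[symmetric] by (simp add: field_simps)
      have off: "norm (G z) \<le> D * exp (pi * K / 2 * (norm z)\<^sup>2)" if z: "z \<notin> centre ` I" for z
      proof -
        define j where "j = cell z"
        \<comment> \<open>The factor by which the exchange in cell \<open>i\<close> changes the
          modulus.\<close>
        define R where "R i = norm (P i z) / norm (z - centre i) ^ K" for i
        have zi: "norm (z - centre i) > 0" if "i \<in> I" for i using z that by auto
        have "norm (gsigma z) ^ K * (\<Prod>i\<in>I. R i) = norm (k z) ^ K * (\<Prod>i\<in>I. norm (P i z))"
        proof -
          have "(\<Prod>i\<in>I. norm (P i z)) = (\<Prod>i\<in>I. norm (z - centre i) ^ K) * (\<Prod>i\<in>I. R i)"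
            unfolding prod.distrib[symmetric] using zi by (intro prod.cong) (force simp: R_def)+
          then show ?thesis
            unfolding gk norm_mult power_mult_distrib by (simp add: prod_norm[symmetric] prod_power_distrib)
        qed
        then have GR: "norm (G z) = norm (gsigma z) ^ K * (\<Prod>i\<in>I. R i) / norm (gsigma 0) ^ K"
          by (simp add: G_def norm_mult norm_divide norm_power prod_norm)
        have far: "(\<Prod>i\<in>I - {j}. R i) \<le> exp (27 * B * M)"
        proof -
          have "R i \<le> exp (27 * B * (1 / (1 + norm (z - centre i)) ^ 3))" if i: "i \<in> I - {j}" for i
          proof -
            define r where "r = norm (z - centre i)"
            have r: "1/2 \<le> r" using norm_diff_centre_other[of i z] i by (simp add: j_def r_def)
            \<comment> \<open>As \<open>r\<close> is at least 1/2, \<open>1 + r <= 3 * r\<close>;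
              the cube is the source of the 27.\<close>
            have "(1 + r) ^ 3 \<le> (3 * r) ^ 3" using r by (intro power_mono) auto
            then have "1 / r ^ 3 \<le> 27 / (1 + r) ^ 3"
              using r by (simp add: field_simps power_mult_distrib add_pos_pos)
            then have "B * (1 / r ^ 3) \<le> B * (27 / (1 + r) ^ 3)"
              using B by (intro mult_left_mono) auto
            then have "1 + B / r ^ 3 \<le> 1 + 27 * B * (1 / (1 + r) ^ 3)" by (simp add: mult_ac)
            also have "\<dots> \<le> exp (27 * B * (1 / (1 + r) ^ 3))" by (rule exp_ge_add_one_self)
            finally have "1 + B / r ^ 3 \<le> exp (27 * B * (1 / (1 + r) ^ 3))" .
            moreover have "R i \<le> 1 + B / r ^ 3"
              using P(5)[of z i] r by (simp add: R_def r_def[symmetric] field_simps)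
            ultimately show ?thesis by (simp add: r_def)
          qed
          then have "(\<Prod>i\<in>I - {j}. R i) \<le> (\<Prod>i\<in>I - {j}. exp (27 * B * (1 / (1 + norm (z - centre i)) ^ 3)))"
            by (intro prod_mono) (auto simp: R_def)
          also have "\<dots> = exp (27 * B * (\<Sum>i\<in>I - {j}. 1 / (1 + norm (z - centre i)) ^ 3))"
            using I by (simp add: exp_sum sum_distrib_left)
          also have "(\<Sum>i\<in>I - {j}. 1 / (1 + norm (z - centre i)) ^ 3) =
              (\<Sum>p\<in>centre ` (I - {j}). 1 / (1 + norm (z - p)) ^ 3)"
            by (subst sum.reindex) (auto intro: inj_on_subset[OF inj_centre])
          also have "\<dots> \<le> M"
          proof (rule M(2))
            fix p q assume "p \<in> centre ` (I - {j})" "q \<in> centre ` (I - {j})" "p \<noteq> q"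
            then obtain a b where "p = centre a" "q = centre b" "a \<noteq> b" by blast
            then show "1 \<le> norm (p - q)" using centre_separated by blast
          qed (use I in auto)
          finally show ?thesis using B by (simp add: mult_left_mono)
        qed
        have far0: "0 \<le> (\<Prod>i\<in>I - {j}. R i)" by (intro prod_nonneg) (auto simp: R_def)
        have "norm (gsigma z) ^ K * (\<Prod>i\<in>I. R i) \<le> (C ^ K * B * exp (27 * B * M)) * ?E z ^ K"
        proof (cases "j \<in> I")
          case True
          \<comment> \<open>In the cell of \<open>z\<close> the zero of \<open>gsigma\<close> at the
            centre cancels the denominator of \<open>R j\<close>.\<close>
          have "norm (gsigma z) ^ K * R j \<le> (C * norm (z - centre j) * ?E z) ^ K * R j"
            using Cc[of z j] by (intro mult_right_mono power_mono) (auto simp: R_def)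
          also have "\<dots> = C ^ K * norm (P j z) * ?E z ^ K"
            using zi[OF True] by (simp add: R_def power_mult_distrib)
          also have "\<dots> \<le> C ^ K * B * ?E z ^ K"
            using P(4)[of z j] norm_diff_centre_cell[of z] C(1) B
            by (intro mult_right_mono mult_left_mono) (auto simp: j_def)
          finally have near: "norm (gsigma z) ^ K * R j \<le> C ^ K * B * ?E z ^ K" .
          have "norm (gsigma z) ^ K * (\<Prod>i\<in>I. R i) = (norm (gsigma z) ^ K * R j) * (\<Prod>i\<in>I - {j}. R i)"
            using I True by (simp add: prod.remove mult_ac)
          also have "\<dots> \<le> (C ^ K * B * ?E z ^ K) * exp (27 * B * M)"
            using C(1) B by (intro mult_mono[OF near far _ far0]) auto
          finally show ?thesis by (simp add: mult_ac)
        next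
          case False
          then have "I - {j} = I" by auto
          then have far': "(\<Prod>i\<in>I. R i) \<le> exp (27 * B * M)" "0 \<le> (\<Prod>i\<in>I. R i)" using far far0 by simp_all
          have "norm (gsigma z) ^ K * (\<Prod>i\<in>I. R i) \<le> (C * ?E z) ^ K * exp (27 * B * M)"
            using C far' by (intro mult_mono power_mono) auto
          also have "\<dots> \<le> B * ((C * ?E z) ^ K * exp (27 * B * M))"
            using mult_right_mono[of 1 B "(C * ?E z) ^ K * exp (27 * B * M)"] B C(1) by simp
          finally show ?thesis by (simp add: mult_ac power_mult_distrib)
        qed
        then show ?thesis
          unfolding GR D_def E using g0 by (simp add: divide_right_mono)
      qed
      \<comment> \<open>At the centres \<open>R\<close> divides by zero, so the estimate is carried
        over by continuity: the complement of a finite set is dense.\<close>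
      have "closed {z. norm (G z) \<le> D * exp (pi * K / 2 * (norm z)\<^sup>2)}"
        by (intro closed_Collect_le continuous_intros holomorphic_on_imp_continuous_on holG)
      moreover have "- (centre ` I) \<subseteq> {z. norm (G z) \<le> D * exp (pi * K / 2 * (norm z)\<^sup>2)}"
        using off by auto
      ultimately have "closure (- (centre ` I)) \<subseteq> {z. norm (G z) \<le> D * exp (pi * K / 2 * (norm z)\<^sup>2)}"
        by (rule closure_minimal[rotated])
      moreover have "closure (- (centre ` I)) = UNIV"
        using I by (simp add: closure_complement empty_interior_finite)
      ultimately show ?thesis by auto
    qed
    ultimately show "\<exists>G. G holomorphic_on UNIV \<and> G 0 = 1 \<and> (\<forall>w\<in>S. G w = 0) \<and>
         (\<forall>z. norm (G z) \<le> D * exp (pi * K / 2 * (norm z)\<^sup>2))"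
      using holG by blast
  qed
qed

text \<open>Normal families: the solutions for the first \<open>N\<close> points obey one common
  bound, so a subsequence converges. Each point is a zero of all but finitely many of them, and the
  value at 0 as well as the bound survive the limit.\<close>

lemma interpolate_0:
  fixes \<delta> :: real
  assumes \<delta>: "0 < \<delta>" and K: "3 \<le> K"
  obtains D where "D > 0"
    "\<And>f :: nat \<Rightarrow> complex. (\<And>m. \<delta> \<le> norm (f m)) \<Longrightarrow>
       (\<And>i N. card {w \<in> f ` {..<N}. cell w = i} + 3 \<le> K) \<Longrightarrow>
       \<exists>G. G holomorphic_on UNIV \<and> G 0 = 1 \<and> (\<forall>m. G (f m) = 0) \<and>
         (\<forall>z. norm (G z) \<le> D * exp (pi * K / 2 * (norm z)\<^sup>2))"
proof -
  obtain D where D: "D > 0" and fin: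
    "\<And>S. finite S \<Longrightarrow> (\<And>w. w \<in> S \<Longrightarrow> \<delta> \<le> norm w) \<Longrightarrow>
       (\<And>i. card {w \<in> S. cell w = i} + 3 \<le> K) \<Longrightarrow>
       \<exists>G. G holomorphic_on UNIV \<and> G 0 = 1 \<and> (\<forall>w\<in>S. G w = 0) \<and>
         (\<forall>z. norm (G z) \<le> D * exp (pi * K / 2 * (norm z)\<^sup>2))"
    using interpolate_0_finite[OF \<delta> K] by blast
  show ?thesis
  proof (rule that[OF D])
    fix f :: "nat \<Rightarrow> complex"
    assume low: "\<And>m. \<delta> \<le> norm (f m)" and card: "\<And>i N. card {w \<in> f ` {..<N}. cell w = i} + 3 \<le> K"
    have "\<exists>G. G holomorphic_on UNIV \<and> G 0 = 1 \<and> (\<forall>w\<in>f ` {..<N}. G w = 0) \<and>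
         (\<forall>z. norm (G z) \<le> D * exp (pi * K / 2 * (norm z)\<^sup>2))" for N
      using low card by (intro fin) auto
    then obtain G where G: "\<And>N. G N holomorphic_on UNIV" "\<And>N. G N 0 = 1"
      "\<And>N m. m < N \<Longrightarrow> G N (f m) = 0"
      "\<And>N z. norm (G N z) \<le> D * exp (pi * K / 2 * (norm z)\<^sup>2)"
      by (metis imageI lessThan_iff)
    obtain g r where g: "g holomorphic_on UNIV" "strict_mono (r :: nat \<Rightarrow> nat)"
      "\<And>x. (\<lambda>n. G (r n) x) \<longlonglongrightarrow> g x"
    proof (rule Montel[of UNIV "range G" G])
      fix A :: "complex set" assume "compact A"
      then obtain b where b: "\<And>z. z \<in> A \<Longrightarrow> norm z \<le> b"
        using compact_imp_bounded[OF \<open>compact A\<close>] unfolding bounded_iff by blast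
      show "\<exists>B. \<forall>h\<in>range G. \<forall>z\<in>A. norm (h z) \<le> B"
      proof (intro exI ballI)
        fix h z assume "h \<in> range G" "z \<in> A"
        then have "norm (h z) \<le> D * exp (pi * K / 2 * (norm z)\<^sup>2)" using G(4) by auto
        also have "\<dots> \<le> D * exp (pi * K / 2 * b\<^sup>2)"
          using D b[OF \<open>z \<in> A\<close>] by (intro mult_left_mono) (auto intro!: mult_left_mono power_mono)
        finally show "norm (h z) \<le> D * exp (pi * K / 2 * b\<^sup>2)" .
      qed
    qed (use G(1) in auto)
    have "g 0 = 1" using LIMSEQ_unique[OF g(3)[of 0]] by (simp add: G(2))
    moreover have "g (f m) = 0" for m
    proof -
      have "eventually (\<lambda>n. G (r n) (f m) = 0) sequentially"
        using eventually_gt_at_top[of m]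
      proof eventually_elim
        case (elim n)
        then have "m < r n" using seq_suble[OF g(2), of n] by simp
        then show ?case by (rule G(3))
      qed
      then have "(\<lambda>n. G (r n) (f m)) \<longlonglongrightarrow> 0" by (rule tendsto_eventually)
      then show ?thesis using g(3) LIMSEQ_unique by blast
    qed
    moreover have "norm (g z) \<le> D * exp (pi * K / 2 * (norm z)\<^sup>2)" for z
      by (rule Lim_bounded[OF tendsto_norm[OF g(3)[of z]], of 0]) (use G(4) in blast)
    ultimately show "\<exists>G. G holomorphic_on UNIV \<and> G 0 = 1 \<and> (\<forall>m. G (f m) = 0) \<and>
         (\<forall>z. norm (G z) \<le> D * exp (pi * K / 2 * (norm z)\<^sup>2))"
      using g(1) by blast
  qed
qed

subsection \<open>Interpolation from dual functions\<close>

lemma exp_neg_square_le: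
  fixes \<epsilon> :: real
  assumes "\<epsilon> > 0"
  obtains C where "C > 0" "\<And>t. t \<ge> 0 \<Longrightarrow> exp (- \<epsilon> * t\<^sup>2) \<le> C * (1 / (1 + t) ^ 3)"
proof -
  have "((\<lambda>t. (1 + t) ^ 3 * exp (- \<epsilon> * t\<^sup>2)) \<longlongrightarrow> 0) at_top"
    using assms by real_asymp
  then have "eventually (\<lambda>t. (1 + t) ^ 3 * exp (- \<epsilon> * t\<^sup>2) < 1) at_top"
    by (rule order_tendstoD) simp
  then obtain T where T: "\<And>t. t \<ge> T \<Longrightarrow> (1 + t) ^ 3 * exp (- \<epsilon> * t\<^sup>2) < 1"
    by (auto simp: eventually_at_top_linorder)
  define C where "C = (1 + max T 0) ^ 3"
  have C1: "1 \<le> C" unfolding C_def by (intro one_le_power) auto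
  have "exp (- \<epsilon> * t\<^sup>2) \<le> C * (1 / (1 + t) ^ 3)" if t: "t \<ge> 0" for t
  proof -
    have "(1 + t) ^ 3 * exp (- \<epsilon> * t\<^sup>2) \<le> C"
    proof (cases "t \<ge> T")
      case True
      then show ?thesis using T[of t] C1 by linarith
    next
      case False
      have "(1 + t) ^ 3 * exp (- \<epsilon> * t\<^sup>2) \<le> (1 + max T 0) ^ 3 * 1"
        using False t assms by (intro mult_mono power_mono) auto
      then show ?thesis by (simp add: C_def)
    qed
    then show ?thesis using t by (simp add: field_simps add_pos_nonneg)
  qed
  then show ?thesis using C1 by (intro that[of C]) auto
qed

text \<open>The Gaussian is dominated by a sum over balls: for \<open>norm z\<close> between
  \<open>k\<close> and \<open>k + 1\<close> the \<open>k\<close>-th term suffices. As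
  \<open>pi * (real k + 1)\<^sup>2\<close> is at least 1, the single series \<open>sum2\<close>
  majorises both the terms and their integrals.\<close>

lemma integrable_gaussian_0:
  fixes c :: real
  assumes c: "c > 0"
  shows "integrable lborel (\<lambda>z::complex. exp (- c * (norm z)\<^sup>2))"
proof -
  obtain C where C: "C > 0" "\<And>t. t \<ge> 0 \<Longrightarrow> exp (- (c/2) * t\<^sup>2) \<le> C * (1 / (1 + t) ^ 3)"
    using exp_neg_square_le[of "c/2"] c by auto
  define f where "f k z = indicat_real (ball 0 (real k + 1)) z * exp (- c * (real k)\<^sup>2)" for k and z :: complex
  have sum2: "summable (\<lambda>k. pi * (real k + 1)\<^sup>2 * exp (- c * (real k)\<^sup>2))"
  proof (rule summable_comparison_test)
    show "summable (\<lambda>k. pi * C\<^sup>2 * inverse (real (Suc k) ^ 4))"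
      using inverse_power_summable[of 4, where ?'a = real] by (intro summable_mult) (subst summable_Suc_iff, simp)
    have "pi * (real k + 1)\<^sup>2 * exp (- c * (real k)\<^sup>2) \<le> pi * C\<^sup>2 * inverse (real (Suc k) ^ 4)" for k
    proof -
      have "exp (- c * (real k)\<^sup>2) = (exp (- (c/2) * (real k)\<^sup>2))\<^sup>2"
        by (simp add: power2_eq_square flip: exp_add)
      also have "\<dots> \<le> (C * (1 / (1 + real k) ^ 3))\<^sup>2"
        by (intro power_mono C) auto
      finally have "pi * (real k + 1)\<^sup>2 * exp (- c * (real k)\<^sup>2) \<le> pi * (real k + 1)\<^sup>2 * (C * (1 / (1 + real k) ^ 3))\<^sup>2"
        by (intro mult_left_mono) auto
      also have "\<dots> = pi * C\<^sup>2 * inverse (real (Suc k) ^ 4)"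
      proof -
        have "X\<^sup>2 * (C * (1 / X ^ 3))\<^sup>2 = C\<^sup>2 * inverse (X ^ 4)" if "X > 0" for X :: real
          using that by (simp add: field_simps eval_nat_numeral)
        from this[of "1 + real k"] show ?thesis by (simp add: add.commute mult.assoc)
      qed
      finally show ?thesis .
    qed
    then show "\<exists>N. \<forall>k\<ge>N. norm (pi * (real k + 1)\<^sup>2 * exp (- c * (real k)\<^sup>2)) \<le> pi * C\<^sup>2 * inverse (real (Suc k) ^ 4)"
      by simp
  qed
  have fle: "norm (f k z) \<le> pi * (real k + 1)\<^sup>2 * exp (- c * (real k)\<^sup>2)" for k z
  proof -
    have "1 * 1 \<le> pi * (real k + 1)\<^sup>2" using pi_ge_two by (intro mult_mono one_le_power) auto
    then have "1 * exp (- c * (real k)\<^sup>2) \<le> pi * (real k + 1)\<^sup>2 * exp (- c * (real k)\<^sup>2)"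
      by (intro mult_right_mono) auto
    then show ?thesis by (auto simp: f_def indicator_def)
  qed
  have fint: "integrable lborel (f k)" for k
    unfolding f_def[abs_def] using emeasure_lborel_ball_finite[of "0::complex" "real k + 1"] by auto
  have fsum: "summable (\<lambda>k. norm (f k z))" for z
    by (rule summable_comparison_test[OF _ sum2]) (use fle[of _ z] in auto)
  have "integrable lborel (\<lambda>z. \<Sum>k. f k z)"
  proof (rule integrable_suminf)
    have "(\<integral>z. norm (f k z) \<partial>lborel) = pi * (real k + 1)\<^sup>2 * exp (- c * (real k)\<^sup>2)" for k
      by (simp add: f_def abs_mult content_ball unit_ball_vol_2)
    then show "summable (\<lambda>k. \<integral>z. norm (f k z) \<partial>lborel)" using sum2 by simp
  qed (use fint fsum in auto)
  then show ?thesis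
  proof (rule Bochner_Integration.integrable_bound)
    show "(\<lambda>z::complex. exp (- c * (norm z)\<^sup>2)) \<in> borel_measurable lborel" by measurable
    have "norm (exp (- c * (norm z)\<^sup>2)) \<le> norm (\<Sum>k. f k z)" for z :: complex
    proof -
      define k where "k = nat \<lfloor>norm z\<rfloor>"
      have k: "real k \<le> norm z" "norm z < real k + 1" by (auto simp: k_def)
      have "exp (- c * (norm z)\<^sup>2) \<le> exp (- c * (real k)\<^sup>2)" using k c by (auto intro!: power_mono)
      also have "\<dots> = f k z" using k by (simp add: f_def)
      also have "\<dots> = (\<Sum>i\<in>{k}. f i z)" by simp
      also have "\<dots> \<le> (\<Sum>k. f k z)"
        using summable_norm_cancel[OF fsum[of z]] by (intro sum_le_suminf) (auto simp: f_def)
      finally show ?thesis by simp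
    qed
    then show "AE z in lborel. norm (exp (- c * (norm (z::complex))\<^sup>2)) \<le> norm (\<Sum>k. f k z)" by simp
  qed
qed

lemma gaussian_integral:
  fixes c :: real and a :: complex
  assumes c: "c > 0"
  shows "integrable lborel (\<lambda>z::complex. exp (- c * (norm (z - a))\<^sup>2))"
    and "(\<integral>z. exp (- c * (norm (z - a))\<^sup>2) \<partial>lborel) = (\<integral>z. exp (- c * (norm (z::complex))\<^sup>2) \<partial>lborel)"
proof -
  have eq: "(lborel :: complex measure) = distr lborel borel ((+) (- a))" by (rule lborel_distr_plus[symmetric])
  have m: "(+) (- a) \<in> measurable lborel (borel :: complex measure)" by simp
  have mg: "(\<lambda>z::complex. exp (- c * (norm z)\<^sup>2)) \<in> borel_measurable borel" by measurable
  have "integrable (distr lborel borel ((+) (- a))) (\<lambda>z::complex. exp (- c * (norm z)\<^sup>2))"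
    using integrable_gaussian_0[OF c] eq by simp
  then show "integrable lborel (\<lambda>z::complex. exp (- c * (norm (z - a))\<^sup>2))"
    unfolding integrable_distr_eq[OF m mg] by simp
  show "(\<integral>z. exp (- c * (norm (z - a))\<^sup>2) \<partial>lborel) = (\<integral>z. exp (- c * (norm (z::complex))\<^sup>2) \<partial>lborel)"
    using integral_distr[OF m mg] by (simp flip: eq)
qed

context
  fixes z :: "nat \<Rightarrow> complex" and \<delta> :: real
  assumes \<delta>: "0 < \<delta>" and sep: "\<And>n m. n \<noteq> m \<Longrightarrow> \<delta> \<le> norm (z n - z m)"
begin

lemma separated_inj: "inj z"
proof (rule injI, rule ccontr)
  fix i j assume "z i = z j" "i \<noteq> j"
  with sep[of i j] \<delta> show False by simp
qed

lemma separated_summable: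
  obtains M where "M \<ge> 0" "\<And>\<zeta>. summable (\<lambda>n. 1 / (1 + norm (\<zeta> - z n)) ^ 3)"
    "\<And>\<zeta>. (\<Sum>n. 1 / (1 + norm (\<zeta> - z n)) ^ 3) \<le> M"
proof -
  obtain M where M: "M \<ge> 0"
    "\<And>S \<zeta>. finite S \<Longrightarrow> (\<And>p q. p \<in> S \<Longrightarrow> q \<in> S \<Longrightarrow> p \<noteq> q \<Longrightarrow> \<delta> \<le> norm (p - q)) \<Longrightarrow>
       (\<Sum>p\<in>S. 1 / (1 + norm (\<zeta> - p :: complex)) ^ 3) \<le> M"
    using separated_sum_bounded[OF \<delta>] by blast
  have part: "(\<Sum>n<N. 1 / (1 + norm (\<zeta> - z n)) ^ 3) \<le> M" for N \<zeta>
  proof -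
    have "(\<Sum>n<N. 1 / (1 + norm (\<zeta> - z n)) ^ 3) = (\<Sum>p\<in>z ` {..<N}. 1 / (1 + norm (\<zeta> - p)) ^ 3)"
      by (subst sum.reindex) (auto intro: inj_on_subset[OF separated_inj])
    also have "\<dots> \<le> M"
    proof (rule M(2))
      fix p q assume "p \<in> z ` {..<N}" "q \<in> z ` {..<N}" "p \<noteq> q"
      then obtain n m where "p = z n" "q = z m" "n \<noteq> m" by blast
      then show "\<delta> \<le> norm (p - q)" using sep by blast
    qed simp
    finally show ?thesis .
  qed
  have s: "summable (\<lambda>n. 1 / (1 + norm (\<zeta> - z n)) ^ 3)" for \<zeta>
    by (rule summableI_nonneg_bounded[OF _ part]) simp
  show ?thesis
    by (rule that[OF M(1) s suminf_le_const[OF s part]])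
qed

lemma separated_gaussian_sum:
  fixes c :: real
  assumes c: "c > 0"
  obtains M where "M \<ge> 0" "\<And>\<zeta>. summable (\<lambda>n. exp (- c * (norm (\<zeta> - z n))\<^sup>2))"
    "\<And>\<zeta>. (\<Sum>n. exp (- c * (norm (\<zeta> - z n))\<^sup>2)) \<le> M"
proof -
  obtain M where M: "M \<ge> 0" "\<And>\<zeta>. summable (\<lambda>n. 1 / (1 + norm (\<zeta> - z n)) ^ 3)"
    "\<And>\<zeta>. (\<Sum>n. 1 / (1 + norm (\<zeta> - z n)) ^ 3) \<le> M"
    using separated_summable by blast
  obtain C where C: "C > 0" "\<And>t. t \<ge> 0 \<Longrightarrow> exp (- c * t\<^sup>2) \<le> C * (1 / (1 + t) ^ 3)"
    using exp_neg_square_le[OF c] by blast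
  have sC: "summable (\<lambda>n. C * (1 / (1 + norm (\<zeta> - z n)) ^ 3))" for \<zeta>
    by (intro summable_mult M)
  have s: "summable (\<lambda>n. exp (- c * (norm (\<zeta> - z n))\<^sup>2))" for \<zeta>
    by (rule summable_comparison_test[OF _ sC[of \<zeta>]]) (use C(2) in \<open>auto intro!: exI[of _ 0]\<close>)
  have "(\<Sum>n. exp (- c * (norm (\<zeta> - z n))\<^sup>2)) \<le> C * M" for \<zeta>
  proof -
    have "(\<Sum>n. exp (- c * (norm (\<zeta> - z n))\<^sup>2)) \<le> (\<Sum>n. C * (1 / (1 + norm (\<zeta> - z n)) ^ 3))"
      by (intro suminf_le s sC C(2)) simp
    also have "\<dots> = C * (\<Sum>n. 1 / (1 + norm (\<zeta> - z n)) ^ 3)" by (rule suminf_mult[OF M(2)])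
    also have "\<dots> \<le> C * M" using C(1) M(3) by (intro mult_left_mono) auto
    finally show ?thesis .
  qed
  then show ?thesis using s C(1) M(1) by (intro that[of "C * M"]) auto
qed

text \<open>One series serves every \<open>p\<close>, because the Gaussian factor is summable over
  the sequence uniformly in \<zeta> and its powers are integrable in \<zeta> with an integral that
  does not depend on \<open>n\<close>.\<close>

lemma interpolating_of_dual_functions:
  fixes \<alpha> C \<epsilon> :: real and p :: ennreal and g :: "nat \<Rightarrow> complex \<Rightarrow> complex"
  assumes \<epsilon>: "\<epsilon> > 0" and \<alpha>: "\<alpha> > 0" and C: "C > 0" and p: "p > 0"
    and hol: "\<And>n. g n holomorphic_on UNIV"
    and dual: "\<And>n m. g n (z m) = (if m = n then 1 else 0)"
    and bound: "\<And>n \<zeta>. norm (g n \<zeta>) \<le> C * exp (- (\<alpha> / 2) * (norm (z n))\<^sup>2) *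
        exp (- \<epsilon> * (norm (\<zeta> - z n))\<^sup>2) * exp (\<alpha> / 2 * (norm \<zeta>)\<^sup>2)"
  shows "interpolating_fock p \<alpha> z"
  unfolding interpolating_fock_def
proof (intro conjI allI impI)
  show "inj z" by (rule separated_inj)
  fix v :: "nat \<Rightarrow> complex"
  define a where "a n = norm (v n) * exp (- (\<alpha> / 2) * (norm (z n))^2)" for n
  assume "in_lp p (\<lambda>n. norm (v n) * exp (- (\<alpha> / 2) * (norm (z n))^2))"
  then have lp: "in_lp p a" by (simp add: a_def[abs_def])
  have a0: "a n \<ge> 0" for n by (simp add: a_def)
  define r where "r = enn2real p"
  have r: "r > 0" if "p \<noteq> \<infinity>"
    using p that by (simp add: r_def enn2real_positive_iff less_top)
  have lp': "summable (\<lambda>n. a n powr r)" if "p \<noteq> \<infinity>"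
    using lp that a0 by (simp add: in_lp_def r_def)
  \<comment> \<open>The weighted data are bounded for finite \<open>p\<close> too, so locally
    uniform convergence of the series is proved once for all \<open>p\<close>.\<close>
  have "\<exists>A. \<forall>n. a n \<le> A"
  proof (cases "p = \<infinity>")
    case True
    then have "bounded (range a)" using lp by (simp add: in_lp_def)
    then show ?thesis by (metis abs_le_D1 bounded_iff rangeI real_norm_def)
  next
    case False
    have "a n \<le> (\<Sum>n. a n powr r) powr (1 / r)" for n
    proof -
      have "a n = (a n powr r) powr (1 / r)" using r[OF False] a0 by (simp add: powr_powr)
      also have "\<dots> \<le> (\<Sum>n. a n powr r) powr (1 / r)"
        using sum_le_suminf[OF lp'[OF False], of "{n}"] r[OF False] by (intro powr_mono2) auto
      finally show ?thesis .
    qed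
    then show ?thesis by blast
  qed
  then obtain A where A: "\<And>n. a n \<le> A" by blast
  have A0: "A \<ge> 0" using A[of 0] a0[of 0] by linarith
  let ?e = "\<lambda>c \<zeta> n. exp (- c * (norm (\<zeta> - z n))\<^sup>2)"
  let ?w = "\<lambda>\<zeta>::complex. exp (\<alpha> / 2 * (norm \<zeta>)\<^sup>2)"
  have term_le: "norm (v n * g n \<zeta>) \<le> C * ?w \<zeta> * (a n * ?e \<epsilon> \<zeta> n)" for n \<zeta>
  proof -
    have "norm (v n * g n \<zeta>) \<le> norm (v n) * (C * exp (- (\<alpha> / 2) * (norm (z n))\<^sup>2) * ?e \<epsilon> \<zeta> n * ?w \<zeta>)"
      unfolding norm_mult by (intro mult_left_mono bound) simp
    then show ?thesis by (simp add: a_def mult_ac)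
  qed
  obtain M1 where M1: "M1 \<ge> 0" "\<And>\<zeta>. summable (?e \<epsilon> \<zeta>)" "\<And>\<zeta>. (\<Sum>n. ?e \<epsilon> \<zeta> n) \<le> M1"
    using separated_gaussian_sum[OF \<epsilon>] by blast
  have "\<epsilon> / 2 > 0" using \<epsilon> by simp
  then obtain M2 where M2: "M2 \<ge> 0" "\<And>\<zeta>. summable (?e (\<epsilon> / 2) \<zeta>)" "\<And>\<zeta>. (\<Sum>n. ?e (\<epsilon> / 2) \<zeta> n) \<le> M2"
    by (rule separated_gaussian_sum) blast
  have sa: "summable (\<lambda>n. a n * ?e \<epsilon> \<zeta> n)" for \<zeta>
    by (rule summable_comparison_test[OF _ summable_mult[OF M1(2), of A]])
       (use A a0 in \<open>auto simp: abs_mult intro!: exI[of _ 0] mult_right_mono\<close>)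
  define f where "f \<zeta> = (\<Sum>n. v n * g n \<zeta>)" for \<zeta>
  have holf: "f holomorphic_on UNIV"
  proof (rule holomorphic_uniform_sequence[where f = "\<lambda>N \<zeta>. \<Sum>n<N. v n * g n \<zeta>"])
    show "(\<lambda>\<zeta>. \<Sum>n<N. v n * g n \<zeta>) holomorphic_on UNIV" for N
      by (intro holomorphic_intros hol)
    fix x :: complex
    define \<rho> where "\<rho> = norm x + 1"
    obtain D where D: "D > 0" "\<And>t. t \<ge> 0 \<Longrightarrow> exp (- \<epsilon> * t\<^sup>2) \<le> D * (1 / (1 + t) ^ 3)"
      using exp_neg_square_le[OF \<epsilon>] by blast
    obtain M where M: "\<And>\<zeta>. summable (\<lambda>n. 1 / (1 + norm (\<zeta> - z n)) ^ 3)"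
      using separated_summable by blast
    \<comment> \<open>A majorant free of \<zeta> on the disc:
      \<open>1 + norm (z n) <= (1 + \<rho>) * (1 + norm (\<zeta> - z n))\<close> moves the centre of
      the decay to 0.\<close>
    define m where "m n = C * exp (\<alpha> / 2 * \<rho>\<^sup>2) * (A * (D * ((1 + \<rho>) ^ 3 * (1 / (1 + norm (0 - z n)) ^ 3))))" for n
    have "uniform_limit (cball x 1) (\<lambda>N \<zeta>. \<Sum>n<N. v n * g n \<zeta>) f sequentially"
      unfolding f_def[abs_def]
    proof (rule Weierstrass_m_test)
      show "summable m" unfolding m_def[abs_def] by (intro summable_mult M)
      fix n \<zeta> assume "\<zeta> \<in> cball x 1"
      then have \<zeta>: "norm \<zeta> \<le> \<rho>"
        using norm_triangle_ineq2[of \<zeta> x] by (simp add: \<rho>_def dist_norm norm_minus_commute)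
      have "norm (z n) \<le> norm \<zeta> + norm (\<zeta> - z n)"
        using norm_triangle_ineq4[of \<zeta> "\<zeta> - z n"] by simp
      then have "1 + norm (z n) \<le> 1 + \<rho> + norm (\<zeta> - z n)" using \<zeta> by simp
      also have "\<dots> \<le> (1 + \<rho>) * (1 + norm (\<zeta> - z n))"
        by (simp add: \<rho>_def algebra_simps)
      finally have "(1 + norm (z n)) ^ 3 \<le> ((1 + \<rho>) * (1 + norm (\<zeta> - z n))) ^ 3"
        by (intro power_mono) auto
      then have "(1 + norm (z n)) ^ 3 \<le> (1 + \<rho>) ^ 3 * (1 + norm (\<zeta> - z n)) ^ 3"
        by (simp only: power_mult_distrib)
      moreover have "0 < (1 + norm (z n)) ^ 3" "0 < (1 + norm (\<zeta> - z n)) ^ 3"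
        by (simp_all add: add_pos_nonneg)
      ultimately have "1 / (1 + norm (\<zeta> - z n)) ^ 3 \<le> (1 + \<rho>) ^ 3 * (1 / (1 + norm (0 - z n)) ^ 3)"
        by (simp add: divide_le_eq le_divide_eq)
      then have e: "?e \<epsilon> \<zeta> n \<le> D * ((1 + \<rho>) ^ 3 * (1 / (1 + norm (0 - z n)) ^ 3))"
        using D(2)[of "norm (\<zeta> - z n)"] D(1) by (meson mult_left_mono less_imp_le norm_ge_zero order.trans)
      have "C * ?w \<zeta> * (a n * ?e \<epsilon> \<zeta> n) \<le> m n"
        unfolding m_def using e \<zeta> A A0 a0 C \<alpha>
        by (intro mult_mono) (auto intro!: mult_left_mono power_mono)
      then show "norm (v n * g n \<zeta>) \<le> m n" using term_le[of n \<zeta>] by linarith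
    qed
    then show "\<exists>d>0. cball x d \<subseteq> UNIV \<and> uniform_limit (cball x d) (\<lambda>N \<zeta>. \<Sum>n<N. v n * g n \<zeta>) f sequentially"
      by (intro exI[of _ 1]) auto
  qed simp
  have fz: "f (z m) = v m" for m
  proof -
    have "f (z m) = (\<Sum>n\<in>{m}. v n * g n (z m))"
      unfolding f_def by (rule suminf_finite) (auto simp: dual)
    then show ?thesis by (simp add: dual)
  qed
  have fw: "fock_weight \<alpha> f \<zeta> \<le> C * (\<Sum>n. a n * ?e \<epsilon> \<zeta> n)" for \<zeta>
  proof -
    have sm: "summable (\<lambda>n. C * ?w \<zeta> * (a n * ?e \<epsilon> \<zeta> n))" by (intro summable_mult sa)
    have sn: "summable (\<lambda>n. norm (v n * g n \<zeta>))"
      by (rule summable_comparison_test[OF _ sm]) (use term_le in auto)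
    have "norm (f \<zeta>) \<le> (\<Sum>n. norm (v n * g n \<zeta>))" unfolding f_def by (rule summable_norm[OF sn])
    also have "\<dots> \<le> (\<Sum>n. C * ?w \<zeta> * (a n * ?e \<epsilon> \<zeta> n))" by (intro suminf_le term_le sn sm)
    also have "\<dots> = C * ?w \<zeta> * (\<Sum>n. a n * ?e \<epsilon> \<zeta> n)" by (rule suminf_mult[OF sa])
    finally have "fock_weight \<alpha> f \<zeta> \<le> (C * ?w \<zeta> * (\<Sum>n. a n * ?e \<epsilon> \<zeta> n)) * exp (- (\<alpha> / 2) * (norm \<zeta>)\<^sup>2)"
      unfolding fock_weight_def by (intro mult_right_mono) auto
    also have "\<dots> = C * (\<Sum>n. a n * ?e \<epsilon> \<zeta> n) * (?w \<zeta> * exp (- (\<alpha> / 2) * (norm \<zeta>)\<^sup>2))" by (simp add: mult_ac)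
    also have "?w \<zeta> * exp (- (\<alpha> / 2) * (norm \<zeta>)\<^sup>2) = 1" by (simp flip: exp_add)
    finally show ?thesis by simp
  qed
  have fw0: "fock_weight \<alpha> f \<zeta> \<ge> 0" for \<zeta> by (simp add: fock_weight_def)
  have "in_fock p \<alpha> f"
  proof (cases "p = \<infinity>")
    case True
    have "fock_weight \<alpha> f \<zeta> \<le> C * (A * M1)" for \<zeta>
    proof -
      have "(\<Sum>n. a n * ?e \<epsilon> \<zeta> n) \<le> (\<Sum>n. A * ?e \<epsilon> \<zeta> n)"
        using A by (intro suminf_le sa summable_mult M1 mult_right_mono) auto
      also have "\<dots> = A * (\<Sum>n. ?e \<epsilon> \<zeta> n)" by (rule suminf_mult[OF M1(2)])
      also have "\<dots> \<le> A * M1" using M1 A0 by (intro mult_left_mono) auto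
      finally show ?thesis using fw[of \<zeta>] C by (meson mult_left_mono less_imp_le order.trans)
    qed
    then have "bounded (range (fock_weight \<alpha> f))"
      using fw0 by (auto simp: bounded_iff intro!: exI[of _ "C * (A * M1)"])
    then show ?thesis using True holf by (simp add: in_fock_def)
  next
    case False
    note r = r[OF False]
    \<comment> \<open>Integrates termwise to a multiple of the sum of \<open>a n powr r\<close>,
      since a Gaussian has the same integral wherever it is centred.\<close>
    define T where "T \<zeta> = (\<Sum>n. a n powr r * ?e (\<epsilon> * r / 2) \<zeta> n)" for \<zeta>
    have er: "\<epsilon> * r / 2 > 0" using \<epsilon> r by simp
    have sT: "summable (\<lambda>n. a n powr r * ?e (\<epsilon> * r / 2) \<zeta> n)" for \<zeta>
    proof (rule summable_comparison_test[OF _ lp'[OF False]])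
      have "norm (a n powr r * ?e (\<epsilon> * r / 2) \<zeta> n) \<le> a n powr r" for n
        using er by (simp add: mult_left_le)
      then show "\<exists>N. \<forall>n\<ge>N. norm (a n powr r * ?e (\<epsilon> * r / 2) \<zeta> n) \<le> a n powr r" by blast
    qed
    have T0: "T \<zeta> \<ge> 0" for \<zeta> unfolding T_def by (intro suminf_nonneg sT) auto
    have intT: "integrable lborel T"
      unfolding T_def[abs_def]
    proof (rule integrable_suminf)
      show "integrable lborel (\<lambda>\<zeta>. a n powr r * ?e (\<epsilon> * r / 2) \<zeta> n)" for n
        using gaussian_integral(1)[OF er] by (intro integrable_mult_right) simp
      show "AE \<zeta> in lborel. summable (\<lambda>n. norm (a n powr r * ?e (\<epsilon> * r / 2) \<zeta> n))"
        using sT by simp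
      have "(\<integral>\<zeta>. norm (a n powr r * ?e (\<epsilon> * r / 2) \<zeta> n) \<partial>lborel) =
          a n powr r * (\<integral>\<zeta>. exp (- (\<epsilon> * r / 2) * (norm (\<zeta>::complex))\<^sup>2) \<partial>lborel)" for n
        using gaussian_integral(2)[OF er, of "z n"] by (simp add: abs_mult)
      then show "summable (\<lambda>n. \<integral>\<zeta>. norm (a n powr r * ?e (\<epsilon> * r / 2) \<zeta> n) \<partial>lborel)"
        by (simp only: summable_mult2[OF lp'[OF False]])
    qed
    \<comment> \<open>Splitting the Gaussian in half and using \<open>\<Sum>n. x n * y n \<le> (SUP n. x n) * (\<Sum>n. y n)\<close> instead of
      Hoelder's inequality covers \<open>r < 1\<close> and \<open>r \<ge> 1\<close> at once.\<close>
    have le: "fock_weight \<alpha> f \<zeta> powr r \<le> (C * M2) powr r * T \<zeta>" for \<zeta>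
    proof -
      have half: "?e \<epsilon> \<zeta> n = ?e (\<epsilon> / 2) \<zeta> n * ?e (\<epsilon> / 2) \<zeta> n" for n
        by (simp flip: exp_add)
      have sup: "a n * ?e (\<epsilon> / 2) \<zeta> n \<le> T \<zeta> powr (1 / r)" for n
      proof -
        have "(a n * ?e (\<epsilon> / 2) \<zeta> n) powr r = a n powr r * ?e (\<epsilon> * r / 2) \<zeta> n"
          using a0 by (simp add: powr_mult exp_powr_real field_simps)
        also have "\<dots> \<le> T \<zeta>"
          unfolding T_def using sum_le_suminf[OF sT, of "{n}"] by simp
        finally have "((a n * ?e (\<epsilon> / 2) \<zeta> n) powr r) powr (1 / r) \<le> T \<zeta> powr (1 / r)"
          using r by (intro powr_mono2) auto
        then show ?thesis using r a0 by (simp add: powr_powr)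
      qed
      have "(\<Sum>n. a n * ?e \<epsilon> \<zeta> n) \<le> (\<Sum>n. T \<zeta> powr (1 / r) * ?e (\<epsilon> / 2) \<zeta> n)"
        unfolding half mult.assoc[symmetric]
      proof (intro suminf_le mult_right_mono sup)
        show "summable (\<lambda>n. a n * ?e (\<epsilon> / 2) \<zeta> n * ?e (\<epsilon> / 2) \<zeta> n)"
          using sa[of \<zeta>] unfolding half by (simp only: mult.assoc)
        show "summable (\<lambda>n. T \<zeta> powr (1 / r) * ?e (\<epsilon> / 2) \<zeta> n)" by (intro summable_mult M2)
      qed simp
      also have "\<dots> = T \<zeta> powr (1 / r) * (\<Sum>n. ?e (\<epsilon> / 2) \<zeta> n)" by (rule suminf_mult[OF M2(2)])
      also have "\<dots> \<le> T \<zeta> powr (1 / r) * M2" using M2 by (intro mult_left_mono) auto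
      finally have "fock_weight \<alpha> f \<zeta> \<le> C * (T \<zeta> powr (1 / r) * M2)"
        using fw[of \<zeta>] C by (meson mult_left_mono less_imp_le order.trans)
      then have "fock_weight \<alpha> f \<zeta> powr r \<le> (C * (T \<zeta> powr (1 / r) * M2)) powr r"
        using fw0 r by (intro powr_mono2) auto
      also have "\<dots> = (C * M2) powr r * T \<zeta>"
        using C M2 T0 r by (simp add: powr_mult powr_powr mult_ac)
      finally show ?thesis .
    qed
    have "continuous_on UNIV (fock_weight \<alpha> f)"
      unfolding fock_weight_def[abs_def]
      by (intro continuous_intros holomorphic_on_imp_continuous_on holf)
    then have meas: "fock_weight \<alpha> f \<in> borel_measurable borel"
      by (rule borel_measurable_continuous_onI)
    have "integrable lborel (\<lambda>\<zeta>. fock_weight \<alpha> f \<zeta> powr r)"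
    proof (rule Bochner_Integration.integrable_bound)
      show "integrable lborel (\<lambda>\<zeta>. (C * M2) powr r * T \<zeta>)" using intT by (rule integrable_mult_right)
      show "AE \<zeta> in lborel. norm (fock_weight \<alpha> f \<zeta> powr r) \<le> norm ((C * M2) powr r * T \<zeta>)"
        using le T0 by (intro AE_I2) (simp add: abs_mult)
      show "(\<lambda>\<zeta>. fock_weight \<alpha> f \<zeta> powr r) \<in> borel_measurable lborel"
        using meas by measurable
    qed
    then show ?thesis using False holf by (simp add: in_fock_def r_def)
  qed
  then show "\<exists>f. in_fock p \<alpha> f \<and> (\<forall>n. f (z n) = v n)" using fz by blast
qed

end


section \<open>Choice of the grid and translation to each point\<close>

theorem theorem5:
  fixes \<alpha> :: real and p :: ennreal and z :: "nat \<Rightarrow> complex"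
  assumes "\<alpha> > 0" and "p > 0"
    and "Inf {dist (z n) (z m) | n m. n \<noteq> m} > sqrt (2 * pi / (sqrt 3 * \<alpha>))"
  shows "interpolating_fock p \<alpha> z"
proof -
  define X where "X = {dist (z n) (z m) | n m. n \<noteq> m}"
  define \<delta> where "\<delta> = Inf X"
  have "2 * pi / (sqrt 3 * \<alpha>) \<ge> 0" using assms(1) by simp
  then have \<delta>0: "0 < \<delta>" using assms(3) real_sqrt_ge_zero unfolding \<delta>_def X_def by (meson le_less_trans)
  have "sqrt (2 * pi / (sqrt 3 * \<alpha>)) < sqrt (\<delta>\<^sup>2)"
    using assms(3) \<delta>0 by (simp add: \<delta>_def X_def)
  then have \<delta>2: "2 * pi / (sqrt 3 * \<alpha>) < \<delta>\<^sup>2" by (simp only: real_sqrt_less_iff)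
  have "bdd_below X" by (intro bdd_belowI[of _ 0]) (auto simp: X_def)
  then have sep: "\<delta> \<le> norm (z n - z m)" if "n \<noteq> m" for n m
    unfolding \<delta>_def dist_norm[symmetric] using that by (intro cInf_lower) (auto simp: X_def)
  \<comment> \<open>Points per unit area of the hexagonal lattice with minimal distance \<delta>;
    the hypothesis amounts to \<open>d < \<alpha> / pi\<close>.\<close>
  define d where "d = 2 / (sqrt 3 * \<delta>\<^sup>2)"
  have "d < \<alpha> / pi"
  proof -
    have "2 * pi < \<delta>\<^sup>2 * (sqrt 3 * \<alpha>)" using \<delta>2 assms(1) by (simp add: divide_less_eq)
    then show ?thesis using \<delta>0 by (simp add: d_def divide_less_eq less_divide_eq mult_ac)
  qed
  moreover have d0: "0 < d" using \<delta>0 by (simp add: d_def)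
  \<comment> \<open>Room on both sides: \<beta> above \<open>d\<close> absorbs the border term and
    the three spare degrees, \<beta> below \<open>\<alpha> / pi\<close> leaves a positive
    \<epsilon>.\<close>
  ultimately obtain \<beta> where \<beta>: "d < \<beta>" "\<beta> < \<alpha> / pi" "0 < \<beta>"
    using dense by (metis order.strict_trans)
  define e where "e = 2 * \<delta> / sqrt 3"
  \<comment> \<open>The side \<open>sqrt (K / \<beta>)\<close> gives a cell
    \<open>K / \<beta>\<close> units of area. The left side is then \<open>d / \<beta> * K\<close>
    plus a term of order \<open>sqrt K\<close>, and \<open>d / \<beta> < 1\<close>, so large
    \<open>K\<close> works.\<close>
  obtain K :: nat where K: "d * (sqrt (K / \<beta>) + e)\<^sup>2 + 3 \<le> K"
  proof -
    have "\<beta> - d > 0" using \<beta> by simp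
    then have "filterlim (\<lambda>x::real. (\<beta> - d) * x\<^sup>2 - 2 * d * e * x - (d * e\<^sup>2 + 3)) at_top at_top"
      by real_asymp
    then have "eventually (\<lambda>x. 0 \<le> (\<beta> - d) * x\<^sup>2 - 2 * d * e * x - (d * e\<^sup>2 + 3)) at_top"
      unfolding filterlim_at_top by blast
    moreover have "filterlim (\<lambda>K::nat. sqrt (K / \<beta>)) at_top sequentially"
      using \<beta>(3) by real_asymp
    ultimately have "eventually (\<lambda>K::nat. 0 \<le> (\<beta> - d) * (sqrt (K / \<beta>))\<^sup>2 - 2 * d * e * sqrt (K / \<beta>) - (d * e\<^sup>2 + 3)) sequentially"
      by (rule eventually_compose_filterlim)
    then obtain K :: nat where K: "0 \<le> (\<beta> - d) * (sqrt (K / \<beta>))\<^sup>2 - 2 * d * e * sqrt (K / \<beta>) - (d * e\<^sup>2 + 3)"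
      by (auto simp: eventually_sequentially)
    have "\<beta> * (sqrt (K / \<beta>))\<^sup>2 = K" using \<beta>(3) by simp
    with K have "d * (sqrt (K / \<beta>) + e)\<^sup>2 + 3 \<le> K"
      by (simp add: power2_sum algebra_simps del: real_sqrt_pow2_iff real_sqrt_pow2)
    then show ?thesis by (rule that)
  qed
  define L where "L = sqrt (K / \<beta>)"
  have K3: "3 \<le> K"
  proof -
    have "0 \<le> d * (sqrt (K / \<beta>) + e)\<^sup>2" using d0 by simp
    then show ?thesis using K by linarith
  qed
  have L: "L > 0" "\<beta> * L\<^sup>2 = K" using K3 \<beta> by (auto simp: L_def)
  \<comment> \<open>Undoing the dilation by \<open>L\<close> turns the growth rate
    \<open>pi * K / 2\<close> into \<open>pi * \<beta> / 2\<close>; \<epsilon> is what this leaves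
    of \<open>\<alpha> / 2\<close>.\<close>
  define \<epsilon> where "\<epsilon> = \<alpha> / 2 - pi * K / (2 * L\<^sup>2)"
  have \<epsilon>: "\<epsilon> > 0"
  proof -
    have "pi * K / (2 * L\<^sup>2) = pi * \<beta> / 2" unfolding L(2)[symmetric] using L(1) by simp
    then show ?thesis using \<beta>(2) by (simp add: \<epsilon>_def field_simps)
  qed
  have "\<delta> / L > 0" using \<delta>0 L by simp
  from interpolate_0[OF this K3] obtain D where D: "D > 0" and base:
    "\<And>f :: nat \<Rightarrow> complex. (\<And>m. \<delta> / L \<le> norm (f m)) \<Longrightarrow>
       (\<And>i N. card {w \<in> f ` {..<N}. cell w = i} + 3 \<le> K) \<Longrightarrow>
       \<exists>G. G holomorphic_on UNIV \<and> G 0 = 1 \<and> (\<forall>m. G (f m) = 0) \<and>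
         (\<forall>z. norm (G z) \<le> D * exp (pi * K / 2 * (norm z)\<^sup>2))"
    by blast
  have "\<exists>G. G holomorphic_on UNIV \<and> G 0 = 1 \<and> (\<forall>m. m \<noteq> n \<longrightarrow> G ((z m - z n) / L) = 0) \<and>
         (\<forall>z. norm (G z) \<le> D * exp (pi * K / 2 * (norm z)\<^sup>2))" for n
  proof -
    \<comment> \<open>Enumerates the indices other than \<open>n\<close>: the point
      \<open>z n\<close> itself sits at the origin, from which \<open>base\<close> requires all
      points to keep a distance.\<close>
    define s where "s m = (if m < n then m else Suc m)" for m :: nat
    define f where "f m = (z (s m) - z n) / L" for m
    have sn: "s m \<noteq> n" for m by (auto simp: s_def)
    have injs: "s i = s j \<Longrightarrow> i = j" for i j by (auto simp: s_def split: if_splits)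
    have "\<exists>G. G holomorphic_on UNIV \<and> G 0 = 1 \<and> (\<forall>m. G (f m) = 0) \<and>
         (\<forall>z. norm (G z) \<le> D * exp (pi * K / 2 * (norm z)\<^sup>2))"
    proof (rule base)
      show "\<delta> / L \<le> norm (f m)" for m
        using sep[OF sn] L by (simp add: f_def norm_divide divide_right_mono)
      fix i :: "int \<times> int" and N
      define W where "W = {w \<in> f ` {..<N}. cell w = i}"
      have "real (card W) * (sqrt 3 / 2 * (\<delta> / L)\<^sup>2) \<le> (1 + 2 * (\<delta> / L) / sqrt 3)\<^sup>2"
      proof (rule packing_square)
        show "finite W" by (simp add: W_def)
        show "of_int (fst i) \<le> Re w \<and> Re w \<le> of_int (fst i) + 1 \<and> of_int (snd i) \<le> Im w \<and> Im w \<le> of_int (snd i) + 1"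
          if "w \<in> W" for w
          using that by (auto simp: W_def cell_def)
        fix q q' assume "q \<in> W" "q' \<in> W" "q \<noteq> q'"
        then obtain a b where ab: "q = f a" "q' = f b" "a \<noteq> b" by (auto simp: W_def)
        have "q - q' = (z (s a) - z (s b)) / L" using ab by (simp add: f_def diff_divide_distrib)
        then show "\<delta> / L \<le> norm (q - q')"
          using sep[of "s a" "s b"] injs ab L by (auto simp: norm_divide intro!: divide_right_mono)
      qed (use \<delta>0 L in auto)
      also have "(1 + 2 * (\<delta> / L) / sqrt 3)\<^sup>2 = (L + e)\<^sup>2 / L\<^sup>2"
      proof -
        have "1 + 2 * (\<delta> / L) / sqrt 3 = (L + e) / L" using L by (simp add: e_def field_simps)
        then show ?thesis by (simp add: power_divide)
      qed
      finally have "real (card W) \<le> d * (L + e)\<^sup>2"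
        using L \<delta>0 by (simp add: d_def field_simps)
      then have "real (card W + 3) \<le> K" using K by (simp add: L_def)
      then show "card {w \<in> f ` {..<N}. cell w = i} + 3 \<le> K" by (simp add: W_def)
    qed
    then obtain G where G: "G holomorphic_on UNIV" "G 0 = 1" "\<And>m. G (f m) = 0"
      "\<And>z. norm (G z) \<le> D * exp (pi * K / 2 * (norm z)\<^sup>2)" by blast
    have "G ((z m - z n) / L) = 0" if m: "m \<noteq> n" for m
    proof -
      have "m = s (if m < n then m else m - 1)" using m by (auto simp: s_def)
      then show ?thesis using G(3)[of "if m < n then m else m - 1"] by (simp only: f_def)
    qed
    then show ?thesis using G by blast
  qed
  then obtain G where G: "\<And>n. G n holomorphic_on UNIV" "\<And>n. G n 0 = 1"
    "\<And>n m. m \<noteq> n \<Longrightarrow> G n ((z m - z n) / L) = 0"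
    "\<And>n z. norm (G n z) \<le> D * exp (pi * K / 2 * (norm z)\<^sup>2)"
    by metis
  \<comment> \<open>The exponential is the Weyl factor. With \<open>w = \<zeta> - z n\<close>,
    expanding \<open>(norm (z n + w))\<^sup>2\<close> shows that it trades the weight at
    \<open>w\<close> for the weight at \<zeta> and the constant
    \<open>exp (- (\<alpha> / 2) * (norm (z n))\<^sup>2)\<close>; at \<open>z n\<close> it equals
    1.\<close>
  define g where "g n \<zeta> = exp (of_real \<alpha> * cnj (z n) * (\<zeta> - z n)) * G n ((\<zeta> - z n) / L)" for n \<zeta>
  show ?thesis
  proof (rule interpolating_of_dual_functions[where \<delta> = \<delta> and C = D and \<epsilon> = \<epsilon> and g = g])
    show "g n holomorphic_on UNIV" for n
    proof -
      have h: "(\<lambda>\<zeta>. (\<zeta> - z n) / L) holomorphic_on UNIV"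
        using L by (intro holomorphic_intros) auto
      have "(\<lambda>\<zeta>. G n ((\<zeta> - z n) / L)) holomorphic_on UNIV"
        using holomorphic_on_compose_gen[OF h G(1)] by (simp add: o_def)
      then show ?thesis unfolding g_def[abs_def] by (intro holomorphic_intros)
    qed
    show "g n (z m) = (if m = n then 1 else 0)" for n m
      using G(2)[of n] G(3)[of m n] by (auto simp: g_def)
    fix n \<zeta>
    define w where "w = \<zeta> - z n"
    have "norm (G n (w / L)) \<le> D * exp (pi * K / 2 * (norm (w / L))\<^sup>2)" by (rule G(4))
    also have "pi * K / 2 * (norm (w / L))\<^sup>2 = (\<alpha> / 2 - \<epsilon>) * (norm w)\<^sup>2"
      using L by (simp add: \<epsilon>_def norm_divide power_divide)
    finally have "norm (g n \<zeta>) \<le> exp (\<alpha> * Re (cnj (z n) * w)) * (D * exp ((\<alpha> / 2 - \<epsilon>) * (norm w)\<^sup>2))"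
      unfolding g_def norm_mult w_def by (intro mult_mono) (auto simp: mult.assoc)
    also have "\<dots> = D * exp (\<alpha> * Re (cnj (z n) * w) + (\<alpha> / 2 - \<epsilon>) * (norm w)\<^sup>2)"
      by (simp add: exp_add)
    also have "\<alpha> * Re (cnj (z n) * w) + (\<alpha> / 2 - \<epsilon>) * (norm w)\<^sup>2 =
        - (\<alpha> / 2) * (norm (z n))\<^sup>2 + - \<epsilon> * (norm w)\<^sup>2 + \<alpha> / 2 * (norm \<zeta>)\<^sup>2"
    proof -
      have "(norm \<zeta>)\<^sup>2 = (norm (z n))\<^sup>2 + 2 * Re (cnj (z n) * w) + (norm w)\<^sup>2"
        unfolding w_def cmod_power2 by (simp add: power2_eq_square algebra_simps)
      then show ?thesis by (simp add: algebra_simps)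
    qed
    finally show "norm (g n \<zeta>) \<le> D * exp (- (\<alpha> / 2) * (norm (z n))\<^sup>2) *
        exp (- \<epsilon> * (norm (\<zeta> - z n))\<^sup>2) * exp (\<alpha> / 2 * (norm \<zeta>)\<^sup>2)"
      by (simp only: exp_add w_def mult.assoc)
  qed (use assms \<delta>0 sep \<epsilon> D in auto)
qed

end
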